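(* Let $(\varphi,\vec\xi,\eta,g)$ be an almost contact metric structure on a smooth manifold $X$ of odd dimension $n$, let $D=\ker\eta$, and let $p:TX\to D$ be the projection along $\mathrm{span}(\vec\xi)$. Then there exists one and only one $N$-prolonged connection $(\nabla,N)$ (that is, an intrinsic linear connection $\nabla$ on $D$ together with an endomorphism $N:D\to D$) such that for all sections $\vec X,\vec Y,\vec Z\in\Gamma D$: 1. $\vec Z\, g(\vec X,\vec Y)=g(\nabla_{\vec Z}\vec X,\vec Y)+g(\vec X,\nabla_{\vec Z}\vec Y)$ (metricity); 2. $\nabla_{\vec X}\vec Y-\nabla_{\vec Y}\vec X-p[\vec X,\vec Y]=0$ (the connection is torsion-free); 3. $N$ is a symmetric endomorphism (with respect to $g$) such that $g(N\vec X,\vec Y)=\frac12 (L_{\vec\xi}g)(\vec X,\vec Y)$.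
   Context: All objects are smooth. An almost contact metric structure $(\varphi,\vec\xi,\eta,g)$ on $X$ consists of a $(1,1)$-tensor field $\varphi$, a vector field $\vec\xi$, a 1-form $\eta$ and a (pseudo-)Riemannian metric $g$ with $\eta(\vec\xi)=1$, $\varphi(\vec\xi)=0$, $\eta\circ\varphi=0$, $\varphi^2\vec X=-\vec X+\eta(\vec X)\vec\xi$, $g(\varphi\vec X,\varphi\vec Y)=g(\vec X,\vec Y)-\eta(\vec X)\eta(\vec Y)$ and $d\eta(\vec\xi,\vec X)=0$ for all vector fields $\vec X,\vec Y$. The distribution $D=\ker\eta$ has rank $n-1$, and $TX=D\oplus\mathrm{span}(\vec\xi)$. $\Gamma D$ is the $C^\infty(X)$-module of sections of $D$ (admissible vector fields). $L_{\vec\xi}$ is the Lie derivative. An intrinsic (interior) linear connection is a map $\nabla:\Gamma D\times\Gamma D\to\Gamma D$ with $\nabla_{f_1\vec u_1+f_2\vec u_2}\vec v=f_1\nabla_{\vec u_1}\vec v+f_2\nabla_{\vec u_2}\vec v$, additive in the second argument, and $\nabla_{\vec u}(f\vec v)=f\nabla_{\vec u}\vec v+(\vec uf)\vec v$, for smooth functions $f,f_1,f_2$. An $N$-prolonged connection is a connection in the vector bundle $\pi:D\to X$ determined by an intrinsic linear connection $\nabla$ and a vector bundle endomorphism $N:D\to D$; it is denoted $(\nabla,N)$. In local coordinates $(x^\alpha)$ on $X$ with $\vec\xi=\partial_n$ and $D=\mathrm{span}(\vec e_a)$, $\vec e_a=\partial_a-\Gamma^n_a\partial_n$ ($a,b,c=1,\dots,n-1$),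 let $x^{n+a}$ be the fiber coordinates on $D$ with respect to $(\vec e_a)$ and $\nabla_{\vec e_a}\vec e_b=\Gamma^c_{ab}\vec e_c$; then the horizontal distribution of $(\nabla,N)$ on the total space $D$ is spanned by $\vec\epsilon_a=\partial_a-\Gamma^n_a\partial_n-\Gamma^b_{ac}x^{n+c}\partial_{n+b}$ and $\vec u=\partial_n-N^a_bx^{n+b}\partial_{n+a}$. Two $N$-prolonged connections are equal iff both $\nabla$ and $N$ coincide. The torsion of the prolonged connection is by definition the torsion $\nabla_{\vec X}\vec Y-\nabla_{\vec Y}\vec X-p[\vec X,\vec Y]$ of $\nabla$. *)

theory Defs
  imports "HOL-Analysis.Analysis"
begin

text \<open>\<open>Ck_on k f S\<close> is only used on open sets \<open>S\<close>. In finite dimension, continuity of every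
  \<open>\<lambda>x. Df(x) v\<close> is continuity of \<open>Df\<close>, so this is k-fold continuous differentiability.\<close>

primrec Ck_on :: "nat \<Rightarrow> ('e::euclidean_space \<Rightarrow> 'f::real_normed_vector) \<Rightarrow> 'e set \<Rightarrow> bool" where
  "Ck_on 0 f S \<longleftrightarrow> continuous_on S f"
| "Ck_on (Suc k) f S \<longleftrightarrow> (\<forall>x\<in>S. f differentiable (at x)) \<and>
     (\<forall>v. Ck_on k (\<lambda>x. frechet_derivative f (at x) v) S)"

definition smooth_on :: "('e::euclidean_space \<Rightarrow> 'f::real_normed_vector) \<Rightarrow> 'e set \<Rightarrow> bool" where
  "smooth_on f S \<longleftrightarrow> (\<forall>k. Ck_on k f S)"

type_synonym ('a, 'n) chart = "'a set \<times> ('a \<Rightarrow> real ^ 'n)"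

definition is_chart :: "('a::topological_space, 'n::finite) chart \<Rightarrow> bool" where
  "is_chart c \<longleftrightarrow> (case c of (U, x) \<Rightarrow>
     open U \<and> open (x ` U) \<and> homeomorphism U (x ` U) x (inv_into U x))"

locale smooth_manifold =
  fixes A :: "('a::{t2_space, second_countable_topology}, 'n::finite) chart set"
  assumes charts: "\<And>c. c \<in> A \<Longrightarrow> is_chart c"
    and cover: "(\<Union>c\<in>A. fst c) = UNIV"
    and compatible: "\<And>U x V y. (U, x) \<in> A \<Longrightarrow> (V, y) \<in> A \<Longrightarrow>
      smooth_on (y \<circ> inv_into U x) (x ` (U \<inter> V))"

definition smooth_functions :: "('a::topological_space, 'n::finite) chart set \<Rightarrow> ('a \<Rightarrow> real) set" where
  "smooth_functions A = {f. \<forall>(U, x)\<in>A. smooth_on (f \<circ> inv_into U x) (x ` U)}"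

text \<open>Tangent vectors at \<open>p\<close> are derivations at \<open>p\<close> of the algebra of smooth functions. They are
  extended by 0 to nonsmooth functions, so that equality of tangent vectors is equality in HOL.\<close>

type_synonym 'a tvec = "('a \<Rightarrow> real) \<Rightarrow> real"
type_synonym 'a vfield = "'a \<Rightarrow> 'a tvec"

definition lincomb :: "real \<Rightarrow> 'a tvec \<Rightarrow> real \<Rightarrow> 'a tvec \<Rightarrow> 'a tvec" where
  "lincomb a v b w = (\<lambda>f. a * v f + b * w f)"

definition zero_tvec :: "'a tvec" where
  "zero_tvec = (\<lambda>f. 0)"

definition tangent_space :: "('a::topological_space, 'n::finite) chart set \<Rightarrow> 'a \<Rightarrow> 'a tvec set" where
  "tangent_space A p = {v.
     (\<forall>f. f \<notin> smooth_functions A \<longrightarrow> v f = 0) \<and>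
     (\<forall>f\<in>smooth_functions A. \<forall>h\<in>smooth_functions A. \<forall>a b.
        v (\<lambda>q. a * f q + b * h q) = a * v f + b * v h) \<and>
     (\<forall>f\<in>smooth_functions A. \<forall>h\<in>smooth_functions A.
        v (\<lambda>q. f q * h q) = v f * h p + f p * v h)}"

definition vf_comb :: "('a \<Rightarrow> real) \<Rightarrow> 'a vfield \<Rightarrow> ('a \<Rightarrow> real) \<Rightarrow> 'a vfield \<Rightarrow> 'a vfield" where
  "vf_comb f X h Y = (\<lambda>p. lincomb (f p) (X p) (h p) (Y p))"

definition vf_deriv :: "'a vfield \<Rightarrow> ('a \<Rightarrow> real) \<Rightarrow> ('a \<Rightarrow> real)" where
  "vf_deriv X f = (\<lambda>p. X p f)"

definition vector_fields :: "('a::topological_space, 'n::finite) chart set \<Rightarrow> 'a vfield set" where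
  "vector_fields A = {X. (\<forall>p. X p \<in> tangent_space A p) \<and>
     (\<forall>f\<in>smooth_functions A. vf_deriv X f \<in> smooth_functions A)}"

definition lie_bracket :: "'a vfield \<Rightarrow> 'a vfield \<Rightarrow> 'a vfield" where
  "lie_bracket X Y = (\<lambda>p f. X p (vf_deriv Y f) - Y p (vf_deriv X f))"

definition linear_form_on :: "'a tvec set \<Rightarrow> ('a tvec \<Rightarrow> real) \<Rightarrow> bool" where
  "linear_form_on S \<alpha> \<longleftrightarrow> (\<forall>v\<in>S. \<forall>w\<in>S. \<forall>a b. \<alpha> (lincomb a v b w) = a * \<alpha> v + b * \<alpha> w)"

definition linear_endo_on :: "'a tvec set \<Rightarrow> ('a tvec \<Rightarrow> 'a tvec) \<Rightarrow> bool" where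
  "linear_endo_on S L \<longleftrightarrow> L \<in> S \<rightarrow> S \<and>
     (\<forall>v\<in>S. \<forall>w\<in>S. \<forall>a b. L (lincomb a v b w) = lincomb a (L v) b (L w))"

definition form_app :: "('a \<Rightarrow> 'a tvec \<Rightarrow> real) \<Rightarrow> 'a vfield \<Rightarrow> ('a \<Rightarrow> real)" where
  "form_app \<eta> X = (\<lambda>p. \<eta> p (X p))"

definition endo_app :: "('a \<Rightarrow> 'a tvec \<Rightarrow> 'a tvec) \<Rightarrow> 'a vfield \<Rightarrow> 'a vfield" where
  "endo_app \<phi> X = (\<lambda>p. \<phi> p (X p))"

definition metric_app :: "('a \<Rightarrow> 'a tvec \<Rightarrow> 'a tvec \<Rightarrow> real) \<Rightarrow> 'a vfield \<Rightarrow> 'a vfield \<Rightarrow> ('a \<Rightarrow> real)" where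
  "metric_app g X Y = (\<lambda>p. g p (X p) (Y p))"

definition one_form :: "('a::topological_space, 'n::finite) chart set \<Rightarrow> ('a \<Rightarrow> 'a tvec \<Rightarrow> real) \<Rightarrow> bool" where
  "one_form A \<eta> \<longleftrightarrow> (\<forall>p. linear_form_on (tangent_space A p) (\<eta> p)) \<and>
     (\<forall>X\<in>vector_fields A. form_app \<eta> X \<in> smooth_functions A)"

definition tensor_field_11 :: "('a::topological_space, 'n::finite) chart set \<Rightarrow> ('a \<Rightarrow> 'a tvec \<Rightarrow> 'a tvec) \<Rightarrow> bool" where
  "tensor_field_11 A \<phi> \<longleftrightarrow> (\<forall>p. linear_endo_on (tangent_space A p) (\<phi> p)) \<and>
     (\<forall>X\<in>vector_fields A. endo_app \<phi> X \<in> vector_fields A)"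

definition pseudo_riemannian_metric ::
    "('a::topological_space, 'n::finite) chart set \<Rightarrow> ('a \<Rightarrow> 'a tvec \<Rightarrow> 'a tvec \<Rightarrow> real) \<Rightarrow> bool" where
  "pseudo_riemannian_metric A g \<longleftrightarrow>
     (\<forall>p. \<forall>v\<in>tangent_space A p. linear_form_on (tangent_space A p) (g p v)) \<and>
     (\<forall>p. \<forall>v\<in>tangent_space A p. \<forall>w\<in>tangent_space A p. g p v w = g p w v) \<and>
     (\<forall>p. \<forall>v\<in>tangent_space A p. (\<forall>w\<in>tangent_space A p. g p v w = 0) \<longrightarrow> v = zero_tvec) \<and>
     (\<forall>X\<in>vector_fields A. \<forall>Y\<in>vector_fields A. metric_app g X Y \<in> smooth_functions A)"

definition ext_deriv :: "('a \<Rightarrow> 'a tvec \<Rightarrow> real) \<Rightarrow> 'a vfield \<Rightarrow> 'a vfield \<Rightarrow> ('a \<Rightarrow> real)" where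
  "ext_deriv \<eta> X Y = (\<lambda>p. vf_deriv X (form_app \<eta> Y) p - vf_deriv Y (form_app \<eta> X) p
     - form_app \<eta> (lie_bracket X Y) p)"

definition lie_deriv_metric ::
    "'a vfield \<Rightarrow> ('a \<Rightarrow> 'a tvec \<Rightarrow> 'a tvec \<Rightarrow> real) \<Rightarrow> 'a vfield \<Rightarrow> 'a vfield \<Rightarrow> ('a \<Rightarrow> real)" where
  "lie_deriv_metric \<xi> g X Y = (\<lambda>p. vf_deriv \<xi> (metric_app g X Y) p
     - metric_app g (lie_bracket \<xi> X) Y p - metric_app g X (lie_bracket \<xi> Y) p)"

locale almost_contact_metric_structure = smooth_manifold A
  for A :: "('a::{t2_space, second_countable_topology}, 'n::finite) chart set" +
  fixes \<phi> :: "'a \<Rightarrow> 'a tvec \<Rightarrow> 'a tvec"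
    and \<xi> :: "'a vfield"
    and \<eta> :: "'a \<Rightarrow> 'a tvec \<Rightarrow> real"
    and g :: "'a \<Rightarrow> 'a tvec \<Rightarrow> 'a tvec \<Rightarrow> real"
  assumes phi_tensor: "tensor_field_11 A \<phi>"
    and xi_field: "\<xi> \<in> vector_fields A"
    and eta_form: "one_form A \<eta>"
    and g_metric: "pseudo_riemannian_metric A g"
    and eta_xi: "\<And>p. \<eta> p (\<xi> p) = 1"
    and phi_xi: "\<And>p. \<phi> p (\<xi> p) = zero_tvec"
    and eta_phi: "\<And>X p. X \<in> vector_fields A \<Longrightarrow> \<eta> p (\<phi> p (X p)) = 0"
    and phi_phi: "\<And>X p. X \<in> vector_fields A \<Longrightarrow>
      \<phi> p (\<phi> p (X p)) = lincomb (- 1) (X p) (\<eta> p (X p)) (\<xi> p)"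
    and g_phi: "\<And>X Y p. X \<in> vector_fields A \<Longrightarrow> Y \<in> vector_fields A \<Longrightarrow>
      g p (\<phi> p (X p)) (\<phi> p (Y p)) = g p (X p) (Y p) - \<eta> p (X p) * \<eta> p (Y p)"
    and d_eta_xi: "\<And>X p. X \<in> vector_fields A \<Longrightarrow> ext_deriv \<eta> \<xi> X p = 0"

definition distribution ::
    "('a::topological_space, 'n::finite) chart set \<Rightarrow> ('a \<Rightarrow> 'a tvec \<Rightarrow> real) \<Rightarrow> 'a \<Rightarrow> 'a tvec set" where
  "distribution A \<eta> p = {v \<in> tangent_space A p. \<eta> p v = 0}"

definition admissible_fields ::
    "('a::topological_space, 'n::finite) chart set \<Rightarrow> ('a \<Rightarrow> 'a tvec \<Rightarrow> real) \<Rightarrow> 'a vfield set" where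
  "admissible_fields A \<eta> = {X \<in> vector_fields A. \<forall>p. X p \<in> distribution A \<eta> p}"

text \<open>As \<open>\<eta>(\<xi>) = 1\<close>, the decomposition along \<open>TX = ker \<eta> \<oplus> span \<xi>\<close> is
  \<open>v = (v - \<eta>(v) \<xi>) + \<eta>(v) \<xi>\<close>; its first component is the projection to \<open>ker \<eta>\<close>.\<close>

definition proj_D :: "'a vfield \<Rightarrow> ('a \<Rightarrow> 'a tvec \<Rightarrow> real) \<Rightarrow> 'a vfield \<Rightarrow> 'a vfield" where
  "proj_D \<xi> \<eta> X = (\<lambda>p. lincomb 1 (X p) (- \<eta> p (X p)) (\<xi> p))"

text \<open>Connections and endomorphisms are extensional functions, so that equality in HOL is equality
  on admissible fields and on the fibres of \<open>D\<close>, respectively.\<close>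

definition intrinsic_connection ::
    "('a::topological_space, 'n::finite) chart set \<Rightarrow> ('a \<Rightarrow> 'a tvec \<Rightarrow> real) \<Rightarrow>
     ('a vfield \<Rightarrow> 'a vfield \<Rightarrow> 'a vfield) \<Rightarrow> bool" where
  "intrinsic_connection A \<eta> nabla \<longleftrightarrow>
     nabla \<in> admissible_fields A \<eta> \<rightarrow>\<^sub>E (admissible_fields A \<eta> \<rightarrow>\<^sub>E admissible_fields A \<eta>) \<and>
     (\<forall>f1\<in>smooth_functions A. \<forall>f2\<in>smooth_functions A.
        \<forall>u1\<in>admissible_fields A \<eta>. \<forall>u2\<in>admissible_fields A \<eta>. \<forall>v\<in>admissible_fields A \<eta>.
        nabla (vf_comb f1 u1 f2 u2) v = vf_comb f1 (nabla u1 v) f2 (nabla u2 v)) \<and>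
     (\<forall>u\<in>admissible_fields A \<eta>. \<forall>v\<in>admissible_fields A \<eta>. \<forall>w\<in>admissible_fields A \<eta>.
        nabla u (vf_comb (\<lambda>p. 1) v (\<lambda>p. 1) w) = vf_comb (\<lambda>p. 1) (nabla u v) (\<lambda>p. 1) (nabla u w)) \<and>
     (\<forall>f\<in>smooth_functions A. \<forall>u\<in>admissible_fields A \<eta>. \<forall>v\<in>admissible_fields A \<eta>.
        nabla u (\<lambda>p h. f p * v p h) = vf_comb f (nabla u v) (vf_deriv u f) v)"

definition bundle_endomorphism ::
    "('a::topological_space, 'n::finite) chart set \<Rightarrow> ('a \<Rightarrow> 'a tvec \<Rightarrow> real) \<Rightarrow>
     ('a \<Rightarrow> 'a tvec \<Rightarrow> 'a tvec) \<Rightarrow> bool" where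
  "bundle_endomorphism A \<eta> N \<longleftrightarrow>
     (\<forall>p. linear_endo_on (distribution A \<eta> p) (N p) \<and> N p \<in> extensional (distribution A \<eta> p)) \<and>
     (\<forall>X\<in>admissible_fields A \<eta>. endo_app N X \<in> admissible_fields A \<eta>)"

text \<open>A prolonged connection is represented by the pair \<open>(nabla, N)\<close> that determines it: its
  horizontal distribution on the total space of \<open>D\<close> is a function of \<open>nabla\<close> and \<open>N\<close>, and prolonged
  connections are equal iff both components are.\<close>

definition prolonged_connection ::
    "('a::topological_space, 'n::finite) chart set \<Rightarrow> ('a \<Rightarrow> 'a tvec \<Rightarrow> real) \<Rightarrow>
     ('a vfield \<Rightarrow> 'a vfield \<Rightarrow> 'a vfield) \<times> ('a \<Rightarrow> 'a tvec \<Rightarrow> 'a tvec) \<Rightarrow> bool" where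
  "prolonged_connection A \<eta> C \<longleftrightarrow> intrinsic_connection A \<eta> (fst C) \<and> bundle_endomorphism A \<eta> (snd C)"

definition torsion ::
    "'a vfield \<Rightarrow> ('a \<Rightarrow> 'a tvec \<Rightarrow> real) \<Rightarrow> ('a vfield \<Rightarrow> 'a vfield \<Rightarrow> 'a vfield) \<Rightarrow>
     'a vfield \<Rightarrow> 'a vfield \<Rightarrow> 'a vfield" where
  "torsion \<xi> \<eta> nabla X Y = (\<lambda>p f. nabla X Y p f - nabla Y X p f - proj_D \<xi> \<eta> (lie_bracket X Y) p f)"

end

theory Submission
  imports Defs
begin

text \<open>
  The pair \<open>(\<nabla>, N)\<close> consists of two independent objects, and each of them is determined by its products
  with admissible fields. For \<open>N\<close> these products are prescribed: \<open>g(N X, Y) = 1/2 (L\<^sub>\<xi> g)(X, Y)\<close>, and symmetry of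
  \<open>N\<close> is symmetry of \<open>L\<^sub>\<xi> g\<close>. For \<open>\<nabla>\<close> they are given by the Koszul formula, which follows from metricity and
  vanishing torsion exactly as for the Levi-Civita connection of a pseudo-Riemannian manifold; indeed \<open>\<nabla>\<close> is
  the projection of that connection to the distribution \<open>D\<close>.

  Uniqueness needs that \<open>g\<close> is nondegenerate on \<open>D\<close>. This holds because \<open>g(X, \<xi>) = \<eta>(X)\<close>, a consequence of the
  compatibility of \<open>g\<close> with \<open>\<phi>\<close>, so that \<open>D\<close> and \<open>\<xi>\<close> are orthogonal (\<open>G_xi\<close>,
  \<open>g_determined_on_distribution\<close>).

  Existence needs a field with prescribed products, that is, the musical isomorphism: every map from vector
  fields to functions that is linear over the smooth functions is \<open>g(Y, \<cdot>)\<close> for a smooth field \<open>Y\<close>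
  (\<open>representing_field\<close>). The Koszul expression and the Lie derivative of \<open>g\<close> are such maps in their last
  argument (\<open>koszul_smooth_linear\<close>, \<open>lie_deriv_metric_smooth_linear\<close>). The isomorphism is proved in local
  frames by Cramer's rule. Since tangent vectors are derivations, the existence of such frames
  (\<open>local_frame_exists\<close>) amounts to the theorem that a derivation at a point is a combination of partial
  derivatives, which is proved from Hadamard's lemma and bump functions.
\<close>

section \<open>Calculus of iterated directional derivatives\<close>

lemma Ck_on_cong:
  assumes "open S" "\<And>x. x \<in> S \<Longrightarrow> f x = h x" "Ck_on k f S"
  shows "Ck_on k h S"
  using assms(2,3)
proof (induction k arbitrary: f h)
  case 0
  then show ?case by (simp cong: continuous_on_cong)
next
  case (Suc k)
  have D: "(h has_derivative frechet_derivative f (at x)) (at x)" if "x \<in> S" for x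
    using Suc.prems that assms(1) frechet_derivative_works
    by (metis Ck_on.simps(2) has_derivative_transform_within_open)
  then have "frechet_derivative f (at x) = frechet_derivative h (at x)" if "x \<in> S" for x
    using frechet_derivative_at that by blast
  moreover have "Ck_on k (\<lambda>x. frechet_derivative f (at x) v) S" for v
    using Suc.prems by simp
  ultimately have "Ck_on k (\<lambda>x. frechet_derivative h (at x) v) S" for v
    using Suc.IH by (metis (no_types, lifting))
  with D show ?case
    by (auto simp: differentiable_def)
qed

text \<open>Sums, products, reciprocals and composites have explicit derivatives, built from functions of the
  same kind and their derivatives. This rule turns such a formula into an induction step on \<open>k\<close>.\<close>

lemma Ck_on_SucI:
  assumes "open S" "\<And>x. x \<in> S \<Longrightarrow> (f has_derivative D x) (at x)"
    and "\<And>v. Ck_on k (\<lambda>x. D x v) S"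
  shows "Ck_on (Suc k) f S"
proof -
  have "D x = frechet_derivative f (at x)" if "x \<in> S" for x
    using assms(2)[OF that] by (rule frechet_derivative_at)
  then have "Ck_on k (\<lambda>x. frechet_derivative f (at x) v) S" for v
    using Ck_on_cong[OF assms(1) _ assms(3)] by simp
  then show ?thesis
    using assms(2) by (auto simp: differentiable_def)
qed

lemma Ck_on_has_derivative:
  assumes "Ck_on (Suc k) f S" "x \<in> S"
  shows "(f has_derivative frechet_derivative f (at x)) (at x)"
  using assms frechet_derivative_works by auto

lemma Ck_on_SucD: "Ck_on (Suc k) f S \<Longrightarrow> Ck_on k f S"
proof (induction k arbitrary: f)
  case 0
  then show ?case
    by (auto intro!: continuous_at_imp_continuous_on differentiable_imp_continuous_within)
next
  case (Suc k)
  then show ?case by (metis Ck_on.simps(2))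
qed

lemma Ck_on_imp_continuous_on: "Ck_on k f S \<Longrightarrow> continuous_on S f"
  by (induction k) (simp_all only: Ck_on.simps(1) Ck_on_SucD)

lemma Ck_on_subset: "Ck_on k f S \<Longrightarrow> T \<subseteq> S \<Longrightarrow> Ck_on k f T"
  by (induction k arbitrary: f) (auto intro: continuous_on_subset)

lemma Ck_on_local:
  assumes "\<And>x. x \<in> S \<Longrightarrow> \<exists>T. open T \<and> x \<in> T \<and> Ck_on k f T"
  shows "Ck_on k f S"
  using assms
proof (induction k arbitrary: f)
  case 0
  have "isCont f x" if "x \<in> S" for x
    using 0[OF that] continuous_on_eq_continuous_at by fastforce
  then show ?case by (simp add: continuous_at_imp_continuous_on)
next
  case (Suc k)
  have "Ck_on k (\<lambda>x. frechet_derivative f (at x) v) S" for v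
    by (rule Suc.IH) (use Suc.prems in fastforce)
  moreover have "f differentiable (at x)" if "x \<in> S" for x
    using Suc.prems[OF that] by auto
  ultimately show ?case by simp
qed

lemma Ck_on_const [intro]: "open S \<Longrightarrow> Ck_on k (\<lambda>x. c) S"
proof (induction k arbitrary: c)
  case (Suc k)
  then show ?case by (intro Ck_on_SucI[where D = "\<lambda>x v. 0"]) auto
qed auto

lemma Ck_on_bounded_linear_compose:
  assumes "bounded_linear L" "open S" "Ck_on k f S"
  shows "Ck_on k (\<lambda>x. L (f x)) S"
  using assms(3)
proof (induction k arbitrary: f)
  case 0
  then show ?case
    using assms(1) bounded_linear.continuous_on by auto
next
  case (Suc k)
  show ?case
  proof (rule Ck_on_SucI[OF assms(2), where D = "\<lambda>x v. L (frechet_derivative f (at x) v)"])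
    show "((\<lambda>x. L (f x)) has_derivative (\<lambda>v. L (frechet_derivative f (at x) v))) (at x)"
      if "x \<in> S" for x
      using bounded_linear.has_derivative[OF assms(1)] Ck_on_has_derivative[OF Suc.prems that] by blast
  qed (use Suc in auto)
qed

lemma Ck_on_ident:
  assumes "open S"
  shows "Ck_on k (\<lambda>x. x) S"
proof (cases k)
  case (Suc j)
  show ?thesis unfolding Suc
    by (rule Ck_on_SucI[OF assms, where D = "\<lambda>x v. v"]) (use assms in auto)
qed auto

lemma Ck_on_linear: "bounded_linear L \<Longrightarrow> open S \<Longrightarrow> Ck_on k L S"
  using Ck_on_bounded_linear_compose[OF _ _ Ck_on_ident] by blast

lemma Ck_on_add:
  assumes "open S" "Ck_on k f S" "Ck_on k h S"
  shows "Ck_on k (\<lambda>x. f x + h x) S"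
  using assms(2,3)
proof (induction k arbitrary: f h)
  case 0
  then show ?case by (auto intro: continuous_intros)
next
  case (Suc k)
  show ?case
    by (rule Ck_on_SucI[OF assms(1),
          where D = "\<lambda>x v. frechet_derivative f (at x) v + frechet_derivative h (at x) v"])
      (use Suc in \<open>auto intro!: has_derivative_add Ck_on_has_derivative\<close>)
qed

lemma Ck_on_sum:
  assumes "open S" "\<And>i. i \<in> I \<Longrightarrow> Ck_on k (f i) S"
  shows "Ck_on k (\<lambda>x. \<Sum>i\<in>I. f i x) S"
  using assms(2)
  by (induction I rule: infinite_finite_induct) (simp_all add: Ck_on_add Ck_on_const assms(1))

lemma Ck_on_mult:
  fixes f h :: "'e::euclidean_space \<Rightarrow> real"
  assumes "open S" "Ck_on k f S" "Ck_on k h S"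
  shows "Ck_on k (\<lambda>x. f x * h x) S"
  using assms(2,3)
proof (induction k arbitrary: f h)
  case 0
  then show ?case by (auto intro: continuous_intros)
next
  case (Suc k)
  show ?case
  proof (rule Ck_on_SucI[OF assms(1), where
        D = "\<lambda>x v. f x * frechet_derivative h (at x) v + frechet_derivative f (at x) v * h x"])
    show "((\<lambda>x. f x * h x) has_derivative
        (\<lambda>v. f x * frechet_derivative h (at x) v + frechet_derivative f (at x) v * h x)) (at x)"
      if "x \<in> S" for x
      by (intro has_derivative_mult Ck_on_has_derivative[OF _ that]) (use Suc.prems in auto)
    show "Ck_on k (\<lambda>x. f x * frechet_derivative h (at x) v + frechet_derivative f (at x) v * h x) S" for v
      using Suc.prems Ck_on_SucD[OF Suc.prems(1)] Ck_on_SucD[OF Suc.prems(2)]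
      by (intro Ck_on_add[OF assms(1)] Suc.IH) auto
  qed
qed

lemma Ck_on_inverse:
  fixes f :: "'e::euclidean_space \<Rightarrow> real"
  assumes "open S" "Ck_on k f S" "\<And>x. x \<in> S \<Longrightarrow> f x \<noteq> 0"
  shows "Ck_on k (\<lambda>x. inverse (f x)) S"
  using assms(2)
proof (induction k)
  case 0
  then show ?case using assms(3) by (auto intro: continuous_intros)
next
  case (Suc k)
  have inv: "Ck_on k (\<lambda>x. inverse (f x)) S" using Suc Ck_on_SucD by blast
  show ?case
  proof (rule Ck_on_SucI[OF assms(1), where
        D = "\<lambda>x v. (- 1) * (inverse (f x) * frechet_derivative f (at x) v * inverse (f x))"])
    show "((\<lambda>x. inverse (f x)) has_derivative
       (\<lambda>v. (- 1) * (inverse (f x) * frechet_derivative f (at x) v * inverse (f x)))) (at x)"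
      if "x \<in> S" for x
      using Ck_on_has_derivative[OF Suc.prems that] assms(3)[OF that]
      by (auto intro!: derivative_eq_intros)
    show "Ck_on k (\<lambda>x. (- 1) * (inverse (f x) * frechet_derivative f (at x) v * inverse (f x))) S" for v
      using Suc.prems inv by (intro Ck_on_mult[OF assms(1)] Ck_on_const[OF assms(1)]) auto
  qed
qed

text \<open>Expanding a differential in the basis separates the dependence on the point from the
  dependence on the direction, so that the chain rule becomes a sum of products of \<open>C\<^sup>k\<close> functions.\<close>

lemma linear_eq_sum_Basis:
  fixes L :: "'e::euclidean_space \<Rightarrow> real"
  assumes "linear L"
  shows "L w = (\<Sum>b\<in>Basis. (w \<bullet> b) * L b)"
proof -
  have "L w = L (\<Sum>b\<in>Basis. (w \<bullet> b) *\<^sub>R b)"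
    by (simp add: euclidean_representation)
  also have "\<dots> = (\<Sum>b\<in>Basis. (w \<bullet> b) * L b)"
    unfolding linear_sum[OF assms] linear_scale[OF assms] by simp
  finally show ?thesis .
qed

lemma Ck_on_compose:
  fixes f :: "'f::euclidean_space \<Rightarrow> real" and h :: "'e::euclidean_space \<Rightarrow> 'f"
  assumes "open S" "open T" "h ` S \<subseteq> T" "Ck_on k h S" "Ck_on k f T"
  shows "Ck_on k (\<lambda>x. f (h x)) S"
  using assms(4,5)
proof (induction k arbitrary: f)
  case 0
  then show ?case using assms(3) by (auto intro: continuous_on_compose2)
next
  case (Suc k)
  let ?D = "\<lambda>x v. \<Sum>b\<in>Basis. (frechet_derivative h (at x) v \<bullet> b) * frechet_derivative f (at (h x)) b"
  show ?case
  proof (rule Ck_on_SucI[OF assms(1), where D = ?D])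
    show "((\<lambda>x. f (h x)) has_derivative ?D x) (at x)" if x: "x \<in> S" for x
    proof -
      have f: "(f has_derivative frechet_derivative f (at (h x))) (at (h x))"
        using assms(3) x by (intro Ck_on_has_derivative[OF Suc.prems(2)]) auto
      have h: "(h has_derivative frechet_derivative h (at x)) (at x)"
        by (rule Ck_on_has_derivative[OF Suc.prems(1) x])
      have "frechet_derivative f (at (h x)) w = (\<Sum>b\<in>Basis. (w \<bullet> b) * frechet_derivative f (at (h x)) b)" for w
        by (rule linear_eq_sum_Basis[OF has_derivative_linear[OF f]])
      then have "?D x = frechet_derivative f (at (h x)) \<circ> frechet_derivative h (at x)"
        unfolding o_def by (intro ext) (rule sym)
      then show ?thesis
        using diff_chain_at[OF h f] by (simp add: o_def)
    qed
    show "Ck_on k (\<lambda>x. ?D x v) S" for v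
    proof (intro Ck_on_sum Ck_on_mult assms(1))
      show "Ck_on k (\<lambda>x. frechet_derivative h (at x) v \<bullet> b) S" for b
        using Suc.prems by (intro Ck_on_bounded_linear_compose[OF bounded_linear_inner_left assms(1)]) auto
      show "Ck_on k (\<lambda>x. frechet_derivative f (at (h x)) b) S" for b
        using Suc.prems by (intro Suc.IH Ck_on_SucD[OF Suc.prems(1)]) auto
    qed
  qed
qed

section \<open>Bump functions on Euclidean space\<close>

text \<open>The family \<open>exp (- 1 / t) / t\<^sup>m\<close>, extended by 0 to \<open>t \<le> 0\<close>, is closed under differentiation up
  to linear combinations. Treating all exponents \<open>m\<close> at once therefore turns smoothness at the
  origin into an induction on \<open>k\<close> in which only continuity has to be checked.\<close>

definition flat :: "nat \<Rightarrow> real \<Rightarrow> real" where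
  "flat m t = (if t > 0 then exp (- inverse t) * inverse t ^ m else 0)"

lemma flat_tendsto_0: "(flat m \<longlongrightarrow> 0) (at 0)"
proof -
  have "((\<lambda>t. inverse t ^ m / exp (inverse t)) \<longlongrightarrow> 0) (at_right (0::real))"
    by (rule filterlim_compose[OF tendsto_power_div_exp_0 filterlim_inverse_at_top_right])
  moreover have "eventually (\<lambda>t. inverse t ^ m / exp (inverse t) = flat m t) (at_right (0::real))"
    by (auto simp: eventually_at_filter flat_def exp_minus field_simps)
  ultimately have "(flat m \<longlongrightarrow> 0) (at_right 0)"
    using Lim_transform_eventually by blast
  moreover have "eventually (\<lambda>t. 0 = flat m t) (at_left 0)"
    by (auto simp: eventually_at_filter flat_def)
  then have "(flat m \<longlongrightarrow> 0) (at_left 0)"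
    using tendsto_eventually by (metis (mono_tags, lifting) eventually_mono)
  ultimately show ?thesis
    by (simp add: filterlim_split_at)
qed

lemma flat_has_derivative:
  "(flat m has_field_derivative flat (m + 2) t - real m * flat (m + 1) t) (at t)"
proof -
  consider "t > 0" | "t < 0" | "t = 0" by linarith
  then show ?thesis
  proof cases
    case 1
    have pow: "((\<lambda>t. inverse t ^ m) has_field_derivative - real m * inverse t ^ (m + 1)) (at t)"
    proof (induction m)
      case (Suc m)
      have inv: "(inverse has_field_derivative - (inverse t * inverse t)) (at t)"
        using DERIV_inverse[of t UNIV] 1 by (simp add: power2_eq_square)
      show ?case
        using DERIV_mult[OF inv Suc] unfolding power_Suc by (rule DERIV_cong) (simp add: algebra_simps)
    qed auto
    have "((\<lambda>t. exp (- inverse t)) has_field_derivative exp (- inverse t) * inverse t ^ 2) (at t)"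
      using 1 by (auto intro!: derivative_eq_intros simp: power2_eq_square)
    from DERIV_mult[OF this pow]
    have "((\<lambda>t. exp (- inverse t) * inverse t ^ m) has_field_derivative
        flat (m + 2) t - real m * flat (m + 1) t) (at t)"
      by (rule DERIV_cong) (use 1 in \<open>simp add: flat_def power_add mult.assoc mult.left_commute power2_eq_square\<close>)
    then show ?thesis
      by (rule has_field_derivative_transform_within_open[of _ _ _ "{0<..}"]) (use 1 in \<open>auto simp: flat_def\<close>)
  next
    case 2
    have "((\<lambda>t. 0) has_field_derivative flat (m + 2) t - real m * flat (m + 1) t) (at t)"
      using 2 by (auto simp: flat_def)
    then show ?thesis
      by (rule has_field_derivative_transform_within_open[of _ _ _ "{..<0}"]) (use 2 in \<open>auto simp: flat_def\<close>)
  next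
    case 3
    \<comment> \<open>The difference quotient at 0 is again a member of the family, and it tends to 0.\<close>
    have "(\<lambda>y. (flat m y - flat m 0) / (y - 0)) = flat (m + 1)"
      by (auto simp: flat_def field_simps)
    then show ?thesis
      using flat_tendsto_0[of "m + 1"] 3 by (simp add: has_field_derivative_iff flat_def)
  qed
qed

lemma Ck_on_flat: "Ck_on k (flat m) UNIV"
proof (induction k arbitrary: m)
  case 0
  show ?case
    using DERIV_isCont[OF flat_has_derivative] by (simp add: continuous_at_imp_continuous_on)
next
  case (Suc k)
  show ?case
  proof (rule Ck_on_SucI[where D = "\<lambda>t v. (flat (m + 2) t + (- real m) * flat (m + 1) t) * v"])
    show "(flat m has_derivative (\<lambda>v. (flat (m + 2) t + (- real m) * flat (m + 1) t) * v)) (at t)" for t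
      using flat_has_derivative[of m t] by (simp add: has_field_derivative_def)
    show "Ck_on k (\<lambda>t. (flat (m + 2) t + (- real m) * flat (m + 1) t) * v) UNIV" for v
      by (rule Ck_on_mult[OF open_UNIV Ck_on_add[OF open_UNIV Suc Ck_on_mult[OF open_UNIV _ Suc]]])
        (auto intro: Ck_on_const)
  qed auto
qed

text \<open>The function is \<open>F u / (F u + F w)\<close> with \<open>F = flat 0\<close>, where \<open>u\<close> is positive exactly inside the ball of
  radius \<open>r\<close> and \<open>w\<close> exactly outside the ball of radius \<open>s\<close>: since \<open>s < r\<close>, the denominator never vanishes.\<close>

lemma bump_on_euclidean:
  fixes a :: "'e::euclidean_space"
  assumes "0 < s" "s < r"
  obtains \<rho> :: "'e \<Rightarrow> real" where "smooth_on \<rho> UNIV"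
    "\<And>x. dist a x \<le> s \<Longrightarrow> \<rho> x = 1" "\<And>x. dist a x \<ge> r \<Longrightarrow> \<rho> x = 0"
    "\<And>x. 0 \<le> \<rho> x" "\<And>x. \<rho> x \<le> 1"
proof
  define u where "u x = r\<^sup>2 - (x - a) \<bullet> (x - a)" for x
  define w where "w x = (x - a) \<bullet> (x - a) - s\<^sup>2" for x
  define \<rho> where "\<rho> x = flat 0 (u x) * inverse (flat 0 (u x) + flat 0 (w x))" for x
  have "(x - a) \<bullet> (x - a) = (dist x a)\<^sup>2" for x
    by (simp add: dist_norm power2_norm_eq_inner)
  then have dist: "(x - a) \<bullet> (x - a) = (dist a x)\<^sup>2" for x
    by (simp add: dist_commute)
  have nonneg: "0 \<le> flat 0 t" for t by (simp add: flat_def)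
  have sr: "s\<^sup>2 < r\<^sup>2" using assms by (simp add: power_strict_mono)
  have pos: "0 < flat 0 (u x) + flat 0 (w x)" for x
  proof -
    have "u x > 0 \<or> w x > 0" using sr by (auto simp: u_def w_def)
    moreover have "flat 0 t > 0" if "t > 0" for t using that by (simp add: flat_def)
    ultimately show ?thesis using nonneg by (meson add_nonneg_pos add_pos_nonneg)
  qed
  have sq: "Ck_on k (\<lambda>x. (x - a) \<bullet> (x - a)) UNIV" for k
  proof -
    have "Ck_on k (\<lambda>x. x \<bullet> b + (- (a \<bullet> b))) UNIV" for b
      by (intro Ck_on_add Ck_on_const Ck_on_linear bounded_linear_inner_left open_UNIV)
    then have "Ck_on k (\<lambda>x. \<Sum>b\<in>Basis. (x \<bullet> b + (- (a \<bullet> b))) * (x \<bullet> b + (- (a \<bullet> b)))) UNIV"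
      by (intro Ck_on_sum Ck_on_mult) auto
    moreover have "(x - a) \<bullet> (x - a) = (\<Sum>b\<in>Basis. (x \<bullet> b + (- (a \<bullet> b))) * (x \<bullet> b + (- (a \<bullet> b))))" for x
      by (subst euclidean_inner) (simp add: inner_diff_left)
    ultimately show ?thesis by (simp only:)
  qed
  have "Ck_on k u UNIV" for k
  proof -
    have "Ck_on k (\<lambda>x. r\<^sup>2 + (- 1) * ((x - a) \<bullet> (x - a))) UNIV"
      by (intro Ck_on_add Ck_on_mult Ck_on_const sq open_UNIV)
    then show ?thesis unfolding u_def[abs_def] by simp
  qed
  then have fu: "Ck_on k (\<lambda>x. flat 0 (u x)) UNIV" for k
    by (rule Ck_on_compose[OF open_UNIV open_UNIV subset_UNIV _ Ck_on_flat])
  have "Ck_on k w UNIV" for k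
  proof -
    have "Ck_on k (\<lambda>x. (x - a) \<bullet> (x - a) + - (s\<^sup>2)) UNIV"
      by (intro Ck_on_add Ck_on_const sq open_UNIV)
    then show ?thesis unfolding w_def[abs_def] by simp
  qed
  then have fw: "Ck_on k (\<lambda>x. flat 0 (w x)) UNIV" for k
    by (rule Ck_on_compose[OF open_UNIV open_UNIV subset_UNIV _ Ck_on_flat])
  show "smooth_on \<rho> UNIV"
    unfolding smooth_on_def \<rho>_def[abs_def]
    using pos by (intro allI Ck_on_mult Ck_on_inverse Ck_on_add fu fw open_UNIV) (metis less_irrefl)
  show "\<rho> x = 1" if "dist a x \<le> s" for x
  proof -
    have "flat 0 (w x) = 0"
    proof -
      have "(dist a x)\<^sup>2 \<le> s\<^sup>2" using power_mono[OF that, of 2] by simp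
      then show ?thesis unfolding flat_def w_def dist by (simp only: diff_gt_0_iff_gt if_not_P not_less)
    qed
    then show ?thesis using pos[of x] by (simp add: \<rho>_def)
  qed
  show "\<rho> x = 0" if "dist a x \<ge> r" for x
  proof -
    have "flat 0 (u x) = 0"
    proof -
      have "r\<^sup>2 \<le> (dist a x)\<^sup>2" using power_mono[OF that, of 2] assms by linarith
      then show ?thesis unfolding flat_def u_def dist by (simp only: diff_gt_0_iff_gt if_not_P not_less)
    qed
    then show ?thesis by (simp add: \<rho>_def)
  qed
  show "0 \<le> \<rho> x" for x using nonneg pos[of x] by (simp add: \<rho>_def)
  show "\<rho> x \<le> 1" for x
    unfolding \<rho>_def divide_inverse[symmetric] using nonneg[of "w x"] pos[of x] by simp
qed

section \<open>Hadamard's lemma\<close>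

lemma radial_mem:
  fixes a :: "'e::euclidean_space"
  assumes "convex B" "a \<in> B" "x \<in> B" "t \<in> {0..1}"
  shows "a + t *\<^sub>R (x - a) \<in> B"
proof -
  have "(1 - t) *\<^sub>R a + t *\<^sub>R x \<in> B"
    using assms by (intro convexD_alt) auto
  then show ?thesis by (simp add: algebra_simps)
qed

lemma continuous_on_radial:
  fixes F :: "'e::euclidean_space \<Rightarrow> 'g::real_normed_vector"
  assumes "convex B" "a \<in> B" "continuous_on B F"
  shows "continuous_on (B \<times> cbox 0 1) (\<lambda>(x, t). t ^ m *\<^sub>R F (a + t *\<^sub>R (x - a)))"
  unfolding case_prod_beta
  using radial_mem[OF assms(1,2)]
  by (intro continuous_intros continuous_on_compose2[OF assms(3)]) auto

text \<open>Differentiation under the integral sign in a direction \<open>v\<close> replaces \<open>F\<close> by its directional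
  derivative and raises the power of \<open>t\<close> by one; the weight \<open>t ^ m\<close> makes this an induction on \<open>k\<close>.\<close>

lemma Ck_on_radial_average:
  fixes F :: "'e::euclidean_space \<Rightarrow> real"
  assumes B: "open B" "convex B" "a \<in> B" and F: "Ck_on k F B"
  shows "Ck_on k (\<lambda>x. integral {0..1} (\<lambda>t. t ^ m * F (a + t *\<^sub>R (x - a)))) B"
  using F
proof (induction k arbitrary: F m)
  case 0
  have "continuous_on B (\<lambda>x. integral (cbox 0 1) (\<lambda>t. t ^ m * F (a + t *\<^sub>R (x - a))))"
    by (rule integral_continuous_on_param)
      (use continuous_on_radial[OF B(2,3), of F m] 0 in \<open>simp add: case_prod_beta\<close>)
  then show ?case by simp
next
  case (Suc k)
  define F' where "F' y = Blinfun (frechet_derivative F (at y))" for y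
  define G where "G x t = t ^ Suc m *\<^sub>R F' (a + t *\<^sub>R (x - a))" for x t
  have der: "(F has_derivative frechet_derivative F (at y)) (at y)" if "y \<in> B" for y
    by (rule Ck_on_has_derivative[OF Suc.prems that])
  have F': "blinfun_apply (F' y) = frechet_derivative F (at y)" if "y \<in> B" for y
    unfolding F'_def by (rule bounded_linear_Blinfun_apply[OF has_derivative_bounded_linear[OF der[OF that]]])
  have cF: "continuous_on B F"
    using der has_derivative_continuous by (blast intro: continuous_at_imp_continuous_on)
  have cF': "continuous_on B F'"
  proof (rule continuous_on_blinfun_componentwise)
    fix i :: 'e
    have "continuous_on B (\<lambda>x. frechet_derivative F (at x) i)"
      using Suc.prems by (intro Ck_on_imp_continuous_on[of k]) simp
    then show "continuous_on B (\<lambda>x. blinfun_apply (F' x) i)"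
      using F' by (simp cong: continuous_on_cong)
  qed
  have contG: "continuous_on (B \<times> cbox 0 1) (\<lambda>(x, t). G x t)"
    unfolding G_def by (rule continuous_on_radial[OF B(2,3) cF'])
  have intG: "G x integrable_on cbox 0 1" if "x \<in> B" for x
  proof -
    have "continuous_on (cbox 0 1) (\<lambda>t. case (x, t) of (x, t) \<Rightarrow> G x t)"
      by (rule continuous_on_compose2[OF contG]) (use that in \<open>auto intro!: continuous_intros\<close>)
    then show ?thesis by (intro integrable_continuous) simp
  qed
  show ?case
  proof (rule Ck_on_SucI[OF B(1), where D = "\<lambda>x. blinfun_apply (integral (cbox 0 1) (G x))"])
    fix x assume x: "x \<in> B"
    have "((\<lambda>x. integral (cbox 0 1) (\<lambda>t. t ^ m * F (a + t *\<^sub>R (x - a)))) has_derivative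
        integral (cbox 0 1) (G x)) (at x within B)"
    proof (rule leibniz_rule[OF _ _ contG x B(2)])
      fix y t assume yt: "y \<in> B" "t \<in> cbox 0 (1::real)"
      then have mem: "a + t *\<^sub>R (y - a) \<in> B"
        using radial_mem[OF B(2,3)] by simp
      have "((\<lambda>x. F (a + t *\<^sub>R (x - a))) has_derivative
          (\<lambda>v. frechet_derivative F (at (a + t *\<^sub>R (y - a))) (t *\<^sub>R v))) (at y within B)"
        using mem by (intro has_derivative_compose[where g = F, OF _ der]) (auto intro!: derivative_eq_intros)
      then have "((\<lambda>x. t ^ m * F (a + t *\<^sub>R (x - a))) has_derivative
          (\<lambda>v. t ^ m * frechet_derivative F (at (a + t *\<^sub>R (y - a))) (t *\<^sub>R v))) (at y within B)"
        by (rule has_derivative_mult_right)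
      moreover have "(\<lambda>v. t ^ m * frechet_derivative F (at (a + t *\<^sub>R (y - a))) (t *\<^sub>R v)) = G y t"
        using linear_scale[OF has_derivative_linear[OF der[OF mem]]] mem
        by (auto simp: G_def F' scaleR_blinfun.rep_eq fun_eq_iff)
      ultimately show "((\<lambda>x. t ^ m * F (a + t *\<^sub>R (x - a))) has_derivative G y t) (at y within B)"
        by simp
    next
      fix y assume "y \<in> B"
      then have "continuous_on (cbox 0 1) (\<lambda>t. case (y, t) of (x, t) \<Rightarrow> t ^ m *\<^sub>R F (a + t *\<^sub>R (x - a)))"
        by (intro continuous_on_compose2[OF continuous_on_radial[OF B(2,3) cF]])
          (auto intro!: continuous_intros)
      then show "(\<lambda>t. t ^ m * F (a + t *\<^sub>R (y - a))) integrable_on cbox 0 1"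
        by (intro integrable_continuous) simp
    qed
    then show "((\<lambda>x. integral {0..1} (\<lambda>t. t ^ m * F (a + t *\<^sub>R (x - a)))) has_derivative
        integral (cbox 0 1) (G x)) (at x)"
      using at_within_open[OF x B(1)] by simp
  next
    fix v
    have "Ck_on k (\<lambda>x. integral {0..1} (\<lambda>t. t ^ Suc m * frechet_derivative F (at (a + t *\<^sub>R (x - a))) v)) B"
      by (rule Suc.IH) (use Suc.prems in simp)
    moreover have "integral {0..1} (\<lambda>t. t ^ Suc m * frechet_derivative F (at (a + t *\<^sub>R (x - a))) v)
        = blinfun_apply (integral (cbox 0 1) (G x)) v" if "x \<in> B" for x
      unfolding blinfun_apply_integral[OF intG[OF that]] unfolding cbox_interval
      using radial_mem[OF B(2,3) that] by (auto simp: G_def F' scaleR_blinfun.rep_eq intro!: integral_cong)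
    ultimately show "Ck_on k (\<lambda>x. blinfun_apply (integral (cbox 0 1) (G x)) v) B"
      by (rule Ck_on_cong[OF B(1), rotated])
  qed
qed

text \<open>The fundamental theorem of calculus along the segment from \<open>a\<close> to \<open>x\<close>, with the differential
  expanded in the basis; the coefficients are averages of partial derivatives, hence smooth.
  A derivation at \<open>a\<close> applied to this formula only sees the partial derivatives of \<open>f\<close> at \<open>a\<close>,
  which is why spaces of derivations are finite-dimensional.\<close>

lemma hadamard:
  fixes f :: "'e::euclidean_space \<Rightarrow> real"
  assumes B: "open B" "convex B" "a \<in> B" and f: "smooth_on f B"
  obtains h :: "'e \<Rightarrow> 'e \<Rightarrow> real" where "\<And>b. smooth_on (h b) B"
    "\<And>x. x \<in> B \<Longrightarrow> f x = f a + (\<Sum>b\<in>Basis. ((x - a) \<bullet> b) * h b x)"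
    "\<And>b. h b a = frechet_derivative f (at a) b"
proof
  define h where "h b x = integral {0..1} (\<lambda>t. frechet_derivative f (at (a + t *\<^sub>R (x - a))) b)" for b x
  have Df: "Ck_on k (\<lambda>x. frechet_derivative f (at x) b) B" for k b
    using f[unfolded smooth_on_def, rule_format, of "Suc k"] by simp
  show "smooth_on (h b) B" for b
    unfolding smooth_on_def h_def[abs_def] using Ck_on_radial_average[OF B Df, where m = 0] by simp
  show "h b a = frechet_derivative f (at a) b" for b
    by (simp add: h_def)
  show "f x = f a + (\<Sum>b\<in>Basis. ((x - a) \<bullet> b) * h b x)" if x: "x \<in> B" for x
  proof -
    define y where "y t = a + t *\<^sub>R (x - a)" for t :: real
    have y: "y t \<in> B" if "t \<in> {0..1}" for t
      using radial_mem[OF B(2,3) x] that by (simp add: y_def)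
    have der: "(f has_derivative frechet_derivative f (at z)) (at z)" if "z \<in> B" for z
      using f that Ck_on_has_derivative unfolding smooth_on_def by blast
    have "((\<lambda>t. f (y t)) has_vector_derivative frechet_derivative f (at (y t)) (x - a)) (at t within {0..1})"
      if t: "t \<in> {0..1}" for t
    proof -
      have "(y has_derivative (\<lambda>s. s *\<^sub>R (x - a))) (at t within {0..1})"
        unfolding y_def by (auto intro!: derivative_eq_intros)
      from has_derivative_compose[OF this der[OF y[OF t]]] show ?thesis
        using linear_scale[OF has_derivative_linear[OF der[OF y[OF t]]]]
        by (simp add: has_vector_derivative_def)
    qed
    then have "((\<lambda>t. frechet_derivative f (at (y t)) (x - a)) has_integral f (y 1) - f (y 0)) {0..1}"
      by (intro fundamental_theorem_of_calculus) auto
    moreover have "frechet_derivative f (at (y t)) (x - a)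
        = (\<Sum>b\<in>Basis. ((x - a) \<bullet> b) * frechet_derivative f (at (y t)) b)" if "t \<in> {0..1}" for t
      by (rule linear_eq_sum_Basis[OF has_derivative_linear[OF der[OF y[OF that]]]])
    ultimately have "((\<lambda>t. \<Sum>b\<in>Basis. ((x - a) \<bullet> b) * frechet_derivative f (at (y t)) b)
        has_integral f (y 1) - f (y 0)) {0..1}"
      by (rule has_integral_eq[rotated])
    then have "((\<lambda>t. \<Sum>b\<in>Basis. ((x - a) \<bullet> b) * frechet_derivative f (at (y t)) b)
        has_integral f x - f a) {0..1}"
      by (simp add: y_def)
    moreover have "((\<lambda>t. \<Sum>b\<in>Basis. ((x - a) \<bullet> b) * frechet_derivative f (at (y t)) b)
        has_integral (\<Sum>b\<in>Basis. ((x - a) \<bullet> b) * h b x)) {0..1}"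
    proof (intro has_integral_sum has_integral_mult_right finite_Basis)
      fix b :: 'e
      have "continuous_on {0..1} (\<lambda>t. frechet_derivative f (at (y t)) b)"
      proof (rule continuous_on_compose2[of B "\<lambda>x. frechet_derivative f (at x) b" _ y])
        show "continuous_on B (\<lambda>x. frechet_derivative f (at x) b)" using Df[of 0 b] by simp
        show "continuous_on {0..1} y" unfolding y_def by (intro continuous_intros)
      qed (use y in blast)
      then show "((\<lambda>t. frechet_derivative f (at (y t)) b) has_integral h b x) {0..1}"
        unfolding h_def y_def[symmetric] by (intro integrable_integral integrable_continuous_real)
    qed
    ultimately have "f x - f a = (\<Sum>b\<in>Basis. ((x - a) \<bullet> b) * h b x)"
      by (rule has_integral_unique)
    then show ?thesis by linarith
  qed
qed

section \<open>Smooth functions on a manifold\<close>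

text \<open>Bump functions and cut-off coordinate functions on the manifold are of this form, and so are the
  derivatives of smooth functions along cut-off coordinate fields.\<close>

definition chart_extension ::
    "'a set \<Rightarrow> ('a \<Rightarrow> real ^ 'n) \<Rightarrow> (real ^ 'n \<Rightarrow> real) \<Rightarrow> 'a \<Rightarrow> real" where
  "chart_extension U x F = (\<lambda>q. if q \<in> U then F (x q) else 0)"

context smooth_manifold
begin

lemma chartD:
  assumes "(U, x) \<in> A"
  shows "open U" "open (x ` U)" "\<And>q. q \<in> U \<Longrightarrow> inv_into U x (x q) = q"
    "continuous_on U x" "continuous_on (x ` U) (inv_into U x)"
  using charts[OF assms] by (auto simp: is_chart_def homeomorphism_def)

lemma chart_image_open:
  assumes "(U, x) \<in> A" "open V" "V \<subseteq> U"
  shows "open (x ` V)"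
proof -
  note c = chartD[OF assms(1)]
  have "open (x ` U \<inter> inv_into U x -` V)"
    by (rule continuous_open_preimage[OF c(5,2) assms(2)])
  moreover have "x ` U \<inter> inv_into U x -` V = x ` V"
    using c(3) assms(3) by force
  ultimately show ?thesis by simp
qed

lemma chart_preimage_open:
  assumes "(U, x) \<in> A" "open S"
  shows "open {q \<in> U. x q \<in> S}"
proof -
  note c = chartD[OF assms(1)]
  have "open (U \<inter> x -` S)"
    by (rule continuous_open_preimage[OF c(4,1) assms(2)])
  then show ?thesis by (simp add: Int_def vimage_def)
qed

lemma chart_at:
  obtains U x where "(U, x) \<in> A" "p \<in> U"
proof -
  obtain c where "c \<in> A" "p \<in> fst c" using cover by blast
  then show thesis using that[of "fst c" "snd c"] by simp
qed

lemma smooth_functionsD: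
  assumes "f \<in> smooth_functions A" "(U, x) \<in> A"
  shows "smooth_on (f \<circ> inv_into U x) (x ` U)"
  using assms by (auto simp: smooth_functions_def)

text \<open>Off the compact image of the support in the manifold the function is 0, and that image is closed
  because the manifold is Hausdorff; on the preimage of \<open>S\<close> it is \<open>F\<close> composed with the chart, hence in
  any other chart \<open>F\<close> composed with a transition map.
  These two open sets cover the manifold.\<close>

lemma chart_extension_smooth:
  assumes A: "(U, x) \<in> A" and S: "open S" "S \<subseteq> x ` U" and F: "smooth_on F S"
    and K: "compact K" "K \<subseteq> S" and zero: "\<And>y. y \<in> x ` U \<Longrightarrow> y \<notin> K \<Longrightarrow> F y = 0"
  shows "chart_extension U x F \<in> smooth_functions A"
  unfolding smooth_functions_def smooth_on_def
proof clarify
  fix V y k assume A': "(V, y) \<in> A"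
  note c = chartD[OF A] and d = chartD[OF A']
  let ?f = "chart_extension U x F \<circ> inv_into V y"
  define K' where "K' = inv_into U x ` K"
  have "compact K'"
    unfolding K'_def using K S(2) c(5) by (meson compact_continuous_image continuous_on_subset subset_trans)
  then have closed: "closed K'" by (rule compact_imp_closed)
  show "Ck_on k ?f (y ` V)"
  proof (rule Ck_on_local)
    fix z assume "z \<in> y ` V"
    then obtain q where q: "q \<in> V" "z = y q" by blast
    show "\<exists>T. open T \<and> z \<in> T \<and> Ck_on k ?f T"
    proof (cases "q \<in> U \<and> x q \<in> S")
      case True
      define T where "T = y ` (V \<inter> {q \<in> U. x q \<in> S})"
      have T: "open T" unfolding T_def
        by (intro chart_image_open[OF A'] open_Int d(1) chart_preimage_open[OF A S(1)]) auto
      have "Ck_on k (x \<circ> inv_into V y) (y ` (V \<inter> U))"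
        using compatible[OF A' A] by (simp add: smooth_on_def)
      then have "Ck_on k (x \<circ> inv_into V y) T"
        by (rule Ck_on_subset) (auto simp: T_def)
      moreover have "(x \<circ> inv_into V y) ` T \<subseteq> S"
        using d(3) by (auto simp: T_def)
      moreover have "Ck_on k F S" using F by (simp add: smooth_on_def)
      ultimately have "Ck_on k (\<lambda>z. F ((x \<circ> inv_into V y) z)) T"
        using Ck_on_compose[OF T S(1)] by blast
      then have "Ck_on k ?f T"
        by (rule Ck_on_cong[OF T, rotated]) (use d(3) in \<open>auto simp: T_def chart_extension_def\<close>)
      then show ?thesis using T True q by (auto simp: T_def)
    next
      case False
      define T where "T = y ` (V - K')"
      have T: "open T" unfolding T_def
        by (intro chart_image_open[OF A'] open_Diff d(1) closed) auto
      have "?f z = 0" if z: "z \<in> T" for z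
      proof -
        obtain q where q: "q \<in> V" "q \<notin> K'" "z = y q" using z by (auto simp: T_def)
        have "x q \<notin> K" if "q \<in> U" using that q(2) c(3)[OF that] by (force simp: K'_def)
        then show ?thesis using q d(3) zero by (simp add: chart_extension_def)
      qed
      then have "Ck_on k ?f T"
        using Ck_on_cong[OF T _ Ck_on_const[OF T], of 0 ?f] by simp
      moreover have "q \<notin> K'"
      proof
        assume "q \<in> K'"
        then obtain w where w: "w \<in> K" "q = inv_into U x w" by (auto simp: K'_def)
        then have "w \<in> S" "w \<in> x ` U" using K(2) S(2) by auto
        then show False using False w(2) by (simp add: inv_into_into f_inv_into_f)
      qed
      ultimately show ?thesis using T q by (auto simp: T_def)
    qed
  qed
qed

lemma smooth_const: "(\<lambda>q. c) \<in> smooth_functions A"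
  unfolding smooth_functions_def smooth_on_def
  using chartD(2) Ck_on_const by (auto simp: o_def)

lemma smooth_add:
  assumes "f \<in> smooth_functions A" "h \<in> smooth_functions A"
  shows "(\<lambda>q. f q + h q) \<in> smooth_functions A"
  using assms chartD(2) unfolding smooth_functions_def smooth_on_def
  by (auto simp: o_def intro!: Ck_on_add)

lemma smooth_mult:
  assumes "f \<in> smooth_functions A" "h \<in> smooth_functions A"
  shows "(\<lambda>q. f q * h q) \<in> smooth_functions A"
  using assms chartD(2) unfolding smooth_functions_def smooth_on_def
  by (auto simp: o_def intro!: Ck_on_mult)

lemma smooth_inverse:
  assumes "f \<in> smooth_functions A" "\<And>q. f q \<noteq> 0"
  shows "(\<lambda>q. inverse (f q)) \<in> smooth_functions A"
  using assms chartD(2) unfolding smooth_functions_def smooth_on_def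
  by (auto simp: o_def intro!: Ck_on_inverse)

lemma smooth_minus: "f \<in> smooth_functions A \<Longrightarrow> (\<lambda>q. - f q) \<in> smooth_functions A"
  using smooth_mult[OF smooth_const[of "-1"]] by simp

lemma smooth_diff:
  "f \<in> smooth_functions A \<Longrightarrow> h \<in> smooth_functions A \<Longrightarrow> (\<lambda>q. f q - h q) \<in> smooth_functions A"
  using smooth_add[OF _ smooth_minus] by simp

lemma smooth_sum:
  "(\<And>i. i \<in> I \<Longrightarrow> f i \<in> smooth_functions A) \<Longrightarrow> (\<lambda>q. \<Sum>i\<in>I. f i q) \<in> smooth_functions A"
  by (induction I rule: infinite_finite_induct) (simp_all add: smooth_const smooth_add)

lemma smooth_prod:
  "(\<And>i. i \<in> I \<Longrightarrow> f i \<in> smooth_functions A) \<Longrightarrow> (\<lambda>q. \<Prod>i\<in>I. f i q) \<in> smooth_functions A"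
  by (induction I rule: infinite_finite_induct) (simp_all add: smooth_const smooth_mult)

lemma smooth_local:
  assumes "\<And>p. \<exists>W h. open W \<and> p \<in> W \<and> h \<in> smooth_functions A \<and> (\<forall>q\<in>W. f q = h q)"
  shows "f \<in> smooth_functions A"
  unfolding smooth_functions_def smooth_on_def
proof clarify
  fix V y k assume A': "(V, y) \<in> A"
  note d = chartD[OF A']
  show "Ck_on k (f \<circ> inv_into V y) (y ` V)"
  proof (rule Ck_on_local)
    fix z assume "z \<in> y ` V"
    then obtain q where q: "q \<in> V" "z = y q" by blast
    obtain W h where W: "open W" "q \<in> W" "h \<in> smooth_functions A" "\<And>q. q \<in> W \<Longrightarrow> f q = h q"
      using assms by meson
    have T: "open (y ` (V \<inter> W))"
      by (intro chart_image_open[OF A'] open_Int d(1) W(1)) auto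
    have "Ck_on k (h \<circ> inv_into V y) (y ` V)"
      using smooth_functionsD[OF W(3) A'] by (simp add: smooth_on_def)
    then have "Ck_on k (h \<circ> inv_into V y) (y ` (V \<inter> W))"
      by (rule Ck_on_subset) auto
    then have "Ck_on k (f \<circ> inv_into V y) (y ` (V \<inter> W))"
      by (rule Ck_on_cong[OF T, rotated]) (use d(3) W(4) in auto)
    then show "\<exists>T. open T \<and> z \<in> T \<and> Ck_on k (f \<circ> inv_into V y) T"
      using T q W(2) by blast
  qed
qed

lemma bump:
  assumes "open W" "p \<in> W"
  obtains b W' where "b \<in> smooth_functions A" "open W'" "p \<in> W'" "\<And>q. q \<in> W' \<Longrightarrow> b q = 1"
    "\<And>q. q \<notin> W \<Longrightarrow> b q = 0" "\<And>q. 0 \<le> b q" "\<And>q. b q \<le> 1"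
proof -
  obtain U x where A: "(U, x) \<in> A" and p: "p \<in> U" by (rule chart_at)
  note c = chartD[OF A]
  have "open (x ` (U \<inter> W))"
    by (intro chart_image_open[OF A] open_Int c(1) assms(1)) auto
  then obtain r where r: "r > 0" "cball (x p) r \<subseteq> x ` (U \<inter> W)"
    using p assms(2) open_contains_cball by (metis IntI imageI)
  obtain \<rho> :: "real ^ 'n \<Rightarrow> real" where \<rho>: "smooth_on \<rho> UNIV"
      "\<And>y. dist (x p) y \<le> r / 2 \<Longrightarrow> \<rho> y = 1" "\<And>y. dist (x p) y \<ge> r \<Longrightarrow> \<rho> y = 0"
      "\<And>y. 0 \<le> \<rho> y" "\<And>y. \<rho> y \<le> 1"
    by (rule bump_on_euclidean[of "r / 2" r "x p"]) (use r in auto)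
  show ?thesis
  proof
    show "chart_extension U x \<rho> \<in> smooth_functions A"
    proof (rule chart_extension_smooth[OF A c(2) order_refl _ compact_cball[of "x p" r]])
      show "smooth_on \<rho> (x ` U)"
        using \<rho>(1) Ck_on_subset unfolding smooth_on_def by blast
      show "\<rho> y = 0" if "y \<notin> cball (x p) r" for y
        using that \<rho>(3) by simp
    qed (use r in blast)
    show "open {q \<in> U. x q \<in> ball (x p) (r / 2)}"
      by (rule chart_preimage_open[OF A open_ball])
    show "p \<in> {q \<in> U. x q \<in> ball (x p) (r / 2)}" using p r by simp
    show "chart_extension U x \<rho> q = 1" if "q \<in> {q \<in> U. x q \<in> ball (x p) (r / 2)}" for q
      using that \<rho>(2) by (simp add: chart_extension_def)
    show "chart_extension U x \<rho> q = 0" if "q \<notin> W" for q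
    proof (cases "q \<in> U")
      case True
      have "x q \<notin> x ` (U \<inter> W)"
      proof
        assume "x q \<in> x ` (U \<inter> W)"
        then obtain q' where q': "x q = x q'" "q' \<in> U \<inter> W" by (rule imageE)
        have "q = q'" using c(3)[OF True] c(3)[of q'] q' by simp
        then show False using q'(2) \<open>q \<notin> W\<close> by simp
      qed
      then have "x q \<notin> cball (x p) r" using r(2) by blast
      then have "\<rho> (x q) = 0" by (intro \<rho>(3)) simp
      then show ?thesis by (simp add: chart_extension_def)
    qed (simp add: chart_extension_def)
  qed (use \<rho>(4,5) in \<open>auto simp: chart_extension_def\<close>)
qed

section \<open>Tangent vectors and local frames\<close>

lemma tangent_nonsmooth: "v \<in> tangent_space A p \<Longrightarrow> f \<notin> smooth_functions A \<Longrightarrow> v f = 0"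
  by (auto simp: tangent_space_def)

lemma tangent_lincomb:
  assumes "v \<in> tangent_space A p" "f \<in> smooth_functions A" "h \<in> smooth_functions A"
  shows "v (\<lambda>q. a * f q + b * h q) = a * v f + b * v h"
  using assms by (auto simp: tangent_space_def)

lemma tangent_mult:
  assumes "v \<in> tangent_space A p" "f \<in> smooth_functions A" "h \<in> smooth_functions A"
  shows "v (\<lambda>q. f q * h q) = v f * h p + f p * v h"
  using assms by (auto simp: tangent_space_def)

lemma tangent_const:
  assumes "v \<in> tangent_space A p"
  shows "v (\<lambda>q. c) = 0"
proof -
  have "v (\<lambda>q. 1) = 0"
    using tangent_mult[OF assms smooth_const smooth_const, of 1 1] by simp
  then show ?thesis
    using tangent_lincomb[OF assms smooth_const smooth_const, of c 1 0 1] by simp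
qed

lemma tangent_add:
  assumes "v \<in> tangent_space A p" "f \<in> smooth_functions A" "h \<in> smooth_functions A"
  shows "v (\<lambda>q. f q + h q) = v f + v h"
  using tangent_lincomb[OF assms, of 1 1] by simp

lemma tangent_diff:
  assumes "v \<in> tangent_space A p" "f \<in> smooth_functions A" "h \<in> smooth_functions A"
  shows "v (\<lambda>q. f q - h q) = v f - v h"
  using tangent_lincomb[OF assms, of 1 "-1"] by simp

lemma tangent_sum:
  assumes "v \<in> tangent_space A p" "\<And>i. i \<in> I \<Longrightarrow> f i \<in> smooth_functions A"
  shows "v (\<lambda>q. \<Sum>i\<in>I. f i q) = (\<Sum>i\<in>I. v (f i))"
  using assms(2)
  by (induction I rule: infinite_finite_induct)
    (simp_all add: tangent_const[OF assms(1)] tangent_add[OF assms(1)] smooth_sum)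

end

lemma sum_Basis_vec:
  fixes F :: "real ^ 'n \<Rightarrow> 'b::comm_monoid_add"
  shows "sum F Basis = (\<Sum>i\<in>UNIV. F (axis i 1))"
proof -
  have Basis: "(Basis :: (real ^ 'n) set) = (\<lambda>i. axis i 1) ` UNIV"
    by (auto simp: Basis_vec_def)
  have inj: "inj (\<lambda>i::'n. axis i (1::real))"
    by (auto intro: injI simp: axis_eq_axis)
  show ?thesis
    unfolding Basis by (subst sum.reindex[OF inj]) (simp add: o_def)
qed

text \<open>A frame \<open>E\<close> on \<open>W\<close> consisting of globally defined fields, with global functions \<open>c\<close> whose
  differentials form the dual coframe on \<open>W\<close>. Globality of both allows them to be multiplied with
  bump functions and inserted into maps defined on global sections only.\<close>

definition local_frame ::
    "('a::topological_space, 'n::finite) chart set \<Rightarrow> 'a set \<Rightarrow> ('n \<Rightarrow> 'a vfield) \<Rightarrow>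
     ('n \<Rightarrow> 'a \<Rightarrow> real) \<Rightarrow> bool" where
  "local_frame A W E c \<longleftrightarrow> open W \<and>
     (\<forall>i. E i \<in> vector_fields A) \<and> (\<forall>i. c i \<in> smooth_functions A) \<and>
     (\<forall>q\<in>W. \<forall>i j. E i q (c j) = (if i = j then 1 else 0)) \<and>
     (\<forall>q\<in>W. \<forall>v\<in>tangent_space A q. \<forall>f. v f = (\<Sum>i\<in>UNIV. v (c i) * E i q f))"

definition coordinate_field ::
    "('a::topological_space, 'n::finite) chart set \<Rightarrow> 'a set \<Rightarrow> ('a \<Rightarrow> real ^ 'n) \<Rightarrow>
     (real ^ 'n \<Rightarrow> real) \<Rightarrow> 'n \<Rightarrow> 'a vfield" where
  "coordinate_field A U x \<rho> i = (\<lambda>q f.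
     if q \<in> U \<and> f \<in> smooth_functions A
     then \<rho> (x q) * frechet_derivative (f \<circ> inv_into U x) (at (x q)) (axis i 1) else 0)"

context smooth_manifold
begin

lemma smooth_function_has_derivative:
  assumes "f \<in> smooth_functions A" "(U, x) \<in> A" "q \<in> U"
  shows "((f \<circ> inv_into U x) has_derivative frechet_derivative (f \<circ> inv_into U x) (at (x q))) (at (x q))"
  using Ck_on_has_derivative smooth_functionsD[OF assms(1,2)] assms(3)
  unfolding smooth_on_def by blast

lemma coordinate_field_vector_field:
  assumes A: "(U, x) \<in> A" and \<rho>: "smooth_on \<rho> UNIV" and K: "compact K" "K \<subseteq> x ` U"
    and zero: "\<And>y. y \<notin> K \<Longrightarrow> \<rho> y = 0"
  shows "coordinate_field A U x \<rho> i \<in> vector_fields A"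
proof -
  note c = chartD[OF A]
  have "coordinate_field A U x \<rho> i q \<in> tangent_space A q" for q
  proof (cases "q \<in> U")
    case True
    note der = smooth_function_has_derivative[OF _ A True]
    have lin: "frechet_derivative ((\<lambda>q. a * f q + b * h q) \<circ> inv_into U x) (at (x q)) w
        = a * frechet_derivative (f \<circ> inv_into U x) (at (x q)) w
          + b * frechet_derivative (h \<circ> inv_into U x) (at (x q)) w"
      if "f \<in> smooth_functions A" "h \<in> smooth_functions A" for f h a b w
    proof -
      have "(((\<lambda>q. a * f q + b * h q) \<circ> inv_into U x) has_derivative
          (\<lambda>w. a * frechet_derivative (f \<circ> inv_into U x) (at (x q)) w
          + b * frechet_derivative (h \<circ> inv_into U x) (at (x q)) w)) (at (x q))"
        using has_derivative_add[OF has_derivative_mult_right[OF der[OF that(1)]]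
            has_derivative_mult_right[OF der[OF that(2)]]] by (simp add: o_def)
      from fun_cong[OF frechet_derivative_at[OF this], of w] show ?thesis by (rule sym)
    qed
    have mult: "frechet_derivative ((\<lambda>q. f q * h q) \<circ> inv_into U x) (at (x q)) w
        = f q * frechet_derivative (h \<circ> inv_into U x) (at (x q)) w
          + frechet_derivative (f \<circ> inv_into U x) (at (x q)) w * h q"
      if "f \<in> smooth_functions A" "h \<in> smooth_functions A" for f h w
    proof -
      have "(((\<lambda>q. f q * h q) \<circ> inv_into U x) has_derivative
          (\<lambda>w. f q * frechet_derivative (h \<circ> inv_into U x) (at (x q)) w
          + frechet_derivative (f \<circ> inv_into U x) (at (x q)) w * h q)) (at (x q))"
        using has_derivative_mult[OF der[OF that(1)] der[OF that(2)]] c(3)[OF True] by (simp add: o_def)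
      from fun_cong[OF frechet_derivative_at[OF this], of w] show ?thesis by (rule sym)
    qed
    show ?thesis
      using True
      by (simp add: tangent_space_def coordinate_field_def smooth_add smooth_mult smooth_const lin mult
          distrib_left mult.left_commute mult.assoc)
  next
    case False
    then show ?thesis by (simp add: tangent_space_def coordinate_field_def)
  qed
  moreover have "vf_deriv (coordinate_field A U x \<rho> i) f \<in> smooth_functions A"
    if f: "f \<in> smooth_functions A" for f
  proof -
    let ?F = "\<lambda>y. \<rho> y * frechet_derivative (f \<circ> inv_into U x) (at y) (axis i 1)"
    have "Ck_on k (\<lambda>y. frechet_derivative (f \<circ> inv_into U x) (at y) (axis i 1)) (x ` U)" for k
      using smooth_functionsD[OF f A, unfolded smooth_on_def, rule_format, of "Suc k"] by simp
    moreover have "Ck_on k \<rho> (x ` U)" for k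
      using \<rho> Ck_on_subset[OF _ subset_UNIV] unfolding smooth_on_def by blast
    ultimately have "smooth_on ?F (x ` U)"
      unfolding smooth_on_def using Ck_on_mult[OF c(2)] by blast
    then have "chart_extension U x ?F \<in> smooth_functions A"
      by (rule chart_extension_smooth[OF A c(2) order_refl _ K]) (simp add: zero)
    moreover have "vf_deriv (coordinate_field A U x \<rho> i) f = chart_extension U x ?F"
      using f by (auto simp: vf_deriv_def coordinate_field_def chart_extension_def)
    ultimately show ?thesis by simp
  qed
  ultimately show ?thesis by (simp add: vector_fields_def)
qed

text \<open>The frame is made of cut-off coordinate fields and cut-off coordinate functions, near the point where
  the cut-off equals 1. To expand a derivation \<open>v\<close> at \<open>q\<close>, Hadamard's formula for \<open>f\<close> around \<open>q\<close> is
  multiplied by a bump function so that it becomes an identity between global smooth functions;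
  applying \<open>v\<close> to it leaves the sum of the products of \<open>v (c i)\<close> with the partial derivatives of \<open>f\<close> at \<open>q\<close>.\<close>

lemma local_frame_exists:
  obtains W E c where "p \<in> W" "local_frame A W E c"
proof -
  obtain U x where A: "(U, x) \<in> A" and p: "p \<in> U" by (rule chart_at)
  note ch = chartD[OF A]
  obtain r where r: "r > 0" "cball (x p) r \<subseteq> x ` U"
    using ch(2) p open_contains_cball by (metis imageI)
  define B where "B = ball (x p) (r / 2)"
  have B: "open B" "convex B" "B \<subseteq> x ` U"
    using r by (auto simp: B_def)
  obtain \<rho> :: "real ^ 'n \<Rightarrow> real" where \<rho>: "smooth_on \<rho> UNIV"
      "\<And>y. dist (x p) y \<le> r / 2 \<Longrightarrow> \<rho> y = 1" "\<And>y. dist (x p) y \<ge> r \<Longrightarrow> \<rho> y = 0"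
    by (rule bump_on_euclidean[of "r / 2" r "x p"]) (use r in auto)
  have \<rho>B: "\<rho> y = 1" if "y \<in> B" for y using that \<rho>(2) by (simp add: B_def)
  have \<rho>K: "\<rho> y = 0" if "y \<notin> cball (x p) r" for y using that \<rho>(3) by simp
  have \<rho>U: "Ck_on k \<rho> (x ` U)" for k
    using \<rho>(1) Ck_on_subset[OF _ subset_UNIV] unfolding smooth_on_def by blast
  define W where "W = {q \<in> U. x q \<in> B}"
  define c where "c i = chart_extension U x (\<lambda>y. \<rho> y * y $ i)" for i
  define E where "E = coordinate_field A U x \<rho>"
  have c: "c i \<in> smooth_functions A" for i
    unfolding c_def
  proof (rule chart_extension_smooth[OF A ch(2) order_refl _ compact_cball r(2)])
    show "smooth_on (\<lambda>y. \<rho> y * y $ i) (x ` U)"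
      unfolding smooth_on_def
      by (intro allI Ck_on_mult Ck_on_linear ch(2) \<rho>U bounded_linear_vec_nth)
  qed (simp add: \<rho>(3))
  have cW: "c i q = x q $ i" if "q \<in> W" for i q
    using that \<rho>B by (simp add: c_def chart_extension_def W_def)
  have "local_frame A W E c"
    unfolding local_frame_def
  proof (intro conjI allI ballI)
    show "open W" unfolding W_def by (rule chart_preimage_open[OF A B(1)])
    show "E i \<in> vector_fields A" for i
      unfolding E_def by (rule coordinate_field_vector_field[OF A \<rho>(1) compact_cball r(2) \<rho>K])
    show "c i \<in> smooth_functions A" for i by (rule c)
    show "E i q (c j) = (if i = j then 1 else 0)" if q: "q \<in> W" for q i j
    proof -
      have qU: "q \<in> U" and qB: "x q \<in> B" using q by (auto simp: W_def)
      have "((\<lambda>y. y $ j) has_derivative (\<lambda>w. w $ j)) (at (x q))"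
        by (intro bounded_linear_imp_has_derivative bounded_linear_vec_nth)
      then have "((c j \<circ> inv_into U x) has_derivative (\<lambda>w. w $ j)) (at (x q))"
      proof (rule has_derivative_transform_within_open[OF _ B(1) qB])
        fix y assume y: "y \<in> B"
        then obtain q' where "q' \<in> U" "y = x q'" using B(3) by blast
        then show "y $ j = (c j \<circ> inv_into U x) y"
          using cW[of q'] y ch(3) by (simp add: W_def)
      qed
      then have "frechet_derivative (c j \<circ> inv_into U x) (at (x q)) = (\<lambda>w. w $ j)"
        using frechet_derivative_at by metis
      then show ?thesis
        using c qU \<rho>B[OF qB] by (simp add: E_def coordinate_field_def axis_def)
    qed
    show "v f = (\<Sum>i\<in>UNIV. v (c i) * E i q f)" if q: "q \<in> W" and v: "v \<in> tangent_space A q" for q v f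
    proof (cases "f \<in> smooth_functions A")
      case f: True
      have qU: "q \<in> U" and qB: "x q \<in> B" using q by (auto simp: W_def)
      let ?f = "f \<circ> inv_into U x"
      have fB: "smooth_on ?f B"
        using smooth_functionsD[OF f A] Ck_on_subset[OF _ B(3)] by (auto simp: smooth_on_def)
      obtain h where h: "\<And>b. smooth_on (h b) B"
        "\<And>y. y \<in> B \<Longrightarrow> ?f y = ?f (x q) + (\<Sum>b\<in>Basis. ((y - x q) \<bullet> b) * h b y)"
        "\<And>b. h b (x q) = frechet_derivative ?f (at (x q)) b"
        by (rule hadamard[OF B(1,2) qB fB]) (blast intro: that)
      obtain t where t: "t > 0" "cball (x q) t \<subseteq> B"
        using B(1) qB open_contains_cball by blast
      obtain \<beta> :: "real ^ 'n \<Rightarrow> real" where \<beta>: "smooth_on \<beta> UNIV"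
          "\<And>y. dist (x q) y \<le> t / 2 \<Longrightarrow> \<beta> y = 1" "\<And>y. dist (x q) y \<ge> t \<Longrightarrow> \<beta> y = 0"
        by (rule bump_on_euclidean[of "t / 2" t "x q"]) (use t in auto)
      have \<beta>B: "Ck_on k \<beta> B" for k
        using \<beta>(1) Ck_on_subset[OF _ subset_UNIV] unfolding smooth_on_def by blast
      define H where "H i = chart_extension U x (\<lambda>y. \<beta> y * h (axis i 1) y)" for i
      define b where "b = chart_extension U x \<beta>"
      have H: "H i \<in> smooth_functions A" for i
        unfolding H_def
      proof (rule chart_extension_smooth[OF A B(1,3) _ compact_cball t(2)])
        show "smooth_on (\<lambda>y. \<beta> y * h (axis i 1) y) B"
          using h(1) \<beta>B unfolding smooth_on_def by (intro allI Ck_on_mult B(1)) auto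
      qed (simp add: \<beta>(3))
      have b: "b \<in> smooth_functions A"
        unfolding b_def
        by (rule chart_extension_smooth[OF A B(1,3) _ compact_cball t(2)])
          (use \<beta>B in \<open>auto simp: smooth_on_def \<beta>(3)\<close>)
      \<comment> \<open>Where \<open>b\<close> and \<open>H\<close> do not vanish, the functions \<open>c\<close> are the coordinates, and this is Hadamard's formula.\<close>
      have "b q' * f q' = f q * b q' + (\<Sum>i\<in>UNIV. (c i q' - c i q) * H i q')" for q'
      proof (cases "q' \<in> U \<and> x q' \<in> cball (x q) t")
        case True
        then have q': "q' \<in> W" and x: "x q' \<in> B" using t by (auto simp: W_def)
        have "f q' = f q + (\<Sum>i\<in>UNIV. (x q' $ i - x q $ i) * h (axis i 1) (x q'))"
          using h(2)[OF x] True qU ch(3) by (simp add: sum_Basis_vec inner_axis)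
        then show ?thesis
          using True by (simp add: cW[OF q'] cW[OF q] H_def b_def chart_extension_def
              distrib_left sum_distrib_left mult_ac)
      next
        case False
        then have "b q' = 0" "H i q' = 0" for i
          using \<beta>(3)[of "x q'"] by (auto simp: b_def H_def chart_extension_def)
        then show ?thesis by simp
      qed
      then have eq: "(\<lambda>q'. b q' * f q') = (\<lambda>q'. f q * b q' + 1 * (\<Sum>i\<in>UNIV. (c i q' - c i q) * H i q'))"
        by simp
      have ci: "(\<lambda>q'. c i q' - c i q) \<in> smooth_functions A" for i
        by (intro smooth_diff c smooth_const)
      have "v b * f q + b q * v f = v (\<lambda>q'. b q' * f q')"
        using tangent_mult[OF v b f] by simp
      also have "\<dots> = f q * v b + 1 * v (\<lambda>q'. \<Sum>i\<in>UNIV. (c i q' - c i q) * H i q')"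
        unfolding eq by (rule tangent_lincomb[OF v b smooth_sum[OF smooth_mult[OF ci H]]])
      also have "v (\<lambda>q'. \<Sum>i\<in>UNIV. (c i q' - c i q) * H i q')
          = (\<Sum>i\<in>UNIV. v (\<lambda>q'. (c i q' - c i q) * H i q'))"
        by (rule tangent_sum[OF v smooth_mult[OF ci H]])
      also have "\<dots> = (\<Sum>i\<in>UNIV. v (c i) * H i q)"
        by (simp add: tangent_mult[OF v ci H] tangent_diff[OF v c smooth_const] tangent_const[OF v])
      finally have "b q * v f = (\<Sum>i\<in>UNIV. v (c i) * H i q)" by simp
      moreover have "\<beta> (x q) = 1" using \<beta>(2) t(1) by simp
      ultimately show ?thesis
        using qU f \<rho>B[OF qB] h(3)
        by (simp add: b_def H_def chart_extension_def E_def coordinate_field_def)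
    qed (simp add: tangent_nonsmooth[OF v] E_def coordinate_field_def)
  qed
  moreover have "p \<in> W" using p r by (simp add: W_def B_def)
  ultimately show thesis by (rule that[rotated])
qed

section \<open>Vector fields\<close>

lemma vector_fieldD:
  assumes "X \<in> vector_fields A"
  shows "X p \<in> tangent_space A p" "f \<in> smooth_functions A \<Longrightarrow> vf_deriv X f \<in> smooth_functions A"
  using assms by (auto simp: vector_fields_def)

lemma vector_fieldI:
  assumes "\<And>p. X p \<in> tangent_space A p"
    and "\<And>f. f \<in> smooth_functions A \<Longrightarrow> (\<lambda>p. X p f) \<in> smooth_functions A"
  shows "X \<in> vector_fields A"
  using assms by (simp add: vector_fields_def vf_deriv_def)

lemma tangent_combination:
  assumes "\<And>i. i \<in> I \<Longrightarrow> v i \<in> tangent_space A p"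
  shows "(\<lambda>f. \<Sum>i\<in>I. a i * v i f) \<in> tangent_space A p"
proof -
  have "(\<Sum>i\<in>I. a i * v i (\<lambda>q. s * f q + t * h q))
      = s * (\<Sum>i\<in>I. a i * v i f) + t * (\<Sum>i\<in>I. a i * v i h)"
    if "f \<in> smooth_functions A" "h \<in> smooth_functions A" for f h s t
  proof -
    have "(\<Sum>i\<in>I. a i * v i (\<lambda>q. s * f q + t * h q)) = (\<Sum>i\<in>I. s * (a i * v i f) + t * (a i * v i h))"
      using tangent_lincomb[OF assms that] by (intro sum.cong) (auto simp: algebra_simps)
    then show ?thesis by (simp add: sum.distrib sum_distrib_left)
  qed
  moreover have "(\<Sum>i\<in>I. a i * v i (\<lambda>q. f q * h q))
      = (\<Sum>i\<in>I. a i * v i f) * h p + f p * (\<Sum>i\<in>I. a i * v i h)"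
    if "f \<in> smooth_functions A" "h \<in> smooth_functions A" for f h
  proof -
    have "(\<Sum>i\<in>I. a i * v i (\<lambda>q. f q * h q)) = (\<Sum>i\<in>I. a i * v i f * h p + f p * (a i * v i h))"
      using tangent_mult[OF assms that] by (intro sum.cong) (auto simp: algebra_simps)
    then show ?thesis by (simp add: sum.distrib sum_distrib_left sum_distrib_right)
  qed
  moreover have "(\<Sum>i\<in>I. a i * v i f) = 0" if "f \<notin> smooth_functions A" for f
    using assms tangent_nonsmooth that by (intro sum.neutral) auto
  ultimately show ?thesis by (simp add: tangent_space_def)
qed

lemma lincomb_tangent:
  assumes "v \<in> tangent_space A p" "w \<in> tangent_space A p"
  shows "lincomb a v b w \<in> tangent_space A p"
  using tangent_combination[of "UNIV :: bool set" "\<lambda>i. if i then v else w" p "\<lambda>i. if i then a else b"] assms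
  by (simp add: lincomb_def UNIV_bool add.commute)

lemma combination_vector_field:
  assumes "\<And>i. i \<in> I \<Longrightarrow> X i \<in> vector_fields A" "\<And>i. i \<in> I \<Longrightarrow> k i \<in> smooth_functions A"
  shows "(\<lambda>p f. \<Sum>i\<in>I. k i p * X i p f) \<in> vector_fields A"
proof (rule vector_fieldI)
  show "(\<lambda>f. \<Sum>i\<in>I. k i p * X i p f) \<in> tangent_space A p" for p
    by (rule tangent_combination[OF vector_fieldD(1)[OF assms(1)]])
  fix f assume f: "f \<in> smooth_functions A"
  show "(\<lambda>p. \<Sum>i\<in>I. k i p * X i p f) \<in> smooth_functions A"
    using vector_fieldD(2)[OF assms(1) f, unfolded vf_deriv_def] by (intro smooth_sum smooth_mult assms(2))
qed

lemma vf_comb_vector_field: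
  assumes "X \<in> vector_fields A" "Y \<in> vector_fields A" "f \<in> smooth_functions A" "h \<in> smooth_functions A"
  shows "vf_comb f X h Y \<in> vector_fields A"
  using combination_vector_field[of "UNIV :: bool set" "\<lambda>i. if i then X else Y" "\<lambda>i. if i then f else h"] assms
  by (simp add: vf_comb_def lincomb_def UNIV_bool add.commute)

lemma zero_vector_field: "(\<lambda>p f. 0) \<in> vector_fields A"
  using combination_vector_field[of "{}"] by simp

lemma lie_bracket_vector_field:
  assumes X: "X \<in> vector_fields A" and Y: "Y \<in> vector_fields A"
  shows "lie_bracket X Y \<in> vector_fields A"
proof -
  note XD = vector_fieldD[OF X] and YD = vector_fieldD[OF Y]
  have "lie_bracket X Y p \<in> tangent_space A p" for p
  proof -
    have lin: "vf_deriv Z (\<lambda>q. a * f q + b * h q) = (\<lambda>q. a * vf_deriv Z f q + b * vf_deriv Z h q)"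
      if "Z \<in> vector_fields A" "f \<in> smooth_functions A" "h \<in> smooth_functions A" for Z f h a b
      using tangent_lincomb[OF vector_fieldD(1)[OF that(1)] that(2,3)] by (simp add: vf_deriv_def)
    have mult: "vf_deriv Z (\<lambda>q. f q * h q) = (\<lambda>q. vf_deriv Z f q * h q + f q * vf_deriv Z h q)"
      if "Z \<in> vector_fields A" "f \<in> smooth_functions A" "h \<in> smooth_functions A" for Z f h
      using tangent_mult[OF vector_fieldD(1)[OF that(1)] that(2,3)] by (simp add: vf_deriv_def)
    have nonsmooth: "vf_deriv Z f = (\<lambda>q. 0)"
      if "Z \<in> vector_fields A" "f \<notin> smooth_functions A" for Z f
      using tangent_nonsmooth[OF vector_fieldD(1)[OF that(1)] that(2)] by (simp add: vf_deriv_def)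
    have "lie_bracket X Y p (\<lambda>q. a * f q + b * h q)
        = a * lie_bracket X Y p f + b * lie_bracket X Y p h"
      if f: "f \<in> smooth_functions A" and h: "h \<in> smooth_functions A" for f h a b
      unfolding lie_bracket_def lin[OF X f h] lin[OF Y f h]
        tangent_lincomb[OF XD(1) YD(2)[OF f] YD(2)[OF h]] tangent_lincomb[OF YD(1) XD(2)[OF f] XD(2)[OF h]]
      by (simp add: algebra_simps)
    moreover have "lie_bracket X Y p (\<lambda>q. f q * h q)
        = lie_bracket X Y p f * h p + f p * lie_bracket X Y p h"
      if f: "f \<in> smooth_functions A" and h: "h \<in> smooth_functions A" for f h
      unfolding lie_bracket_def mult[OF X f h] mult[OF Y f h]
        tangent_add[OF XD(1) smooth_mult[OF YD(2)[OF f] h] smooth_mult[OF f YD(2)[OF h]]]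
        tangent_add[OF YD(1) smooth_mult[OF XD(2)[OF f] h] smooth_mult[OF f XD(2)[OF h]]]
        tangent_mult[OF XD(1) YD(2)[OF f] h] tangent_mult[OF XD(1) f YD(2)[OF h]]
        tangent_mult[OF YD(1) XD(2)[OF f] h] tangent_mult[OF YD(1) f XD(2)[OF h]]
      by (simp add: vf_deriv_def algebra_simps)
    moreover have "lie_bracket X Y p f = 0" if "f \<notin> smooth_functions A" for f
      unfolding lie_bracket_def nonsmooth[OF X that] nonsmooth[OF Y that]
      using tangent_const[OF XD(1)] tangent_const[OF YD(1)] by simp
    ultimately show ?thesis by (simp add: tangent_space_def)
  qed
  moreover have "vf_deriv (lie_bracket X Y) f \<in> smooth_functions A" if "f \<in> smooth_functions A" for f
    using smooth_diff[OF XD(2)[OF YD(2)[OF that]] YD(2)[OF XD(2)[OF that]]]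
    by (simp add: vf_deriv_def lie_bracket_def)
  ultimately show ?thesis by (simp add: vector_fields_def)
qed

lemma vector_field_local:
  assumes "\<And>p. \<exists>W Y. open W \<and> p \<in> W \<and> Y \<in> vector_fields A \<and> (\<forall>q\<in>W. X q = Y q)"
  shows "X \<in> vector_fields A"
proof -
  have "X p \<in> tangent_space A p" for p
    using assms vector_fieldD(1) by metis
  moreover have "vf_deriv X f \<in> smooth_functions A" if f: "f \<in> smooth_functions A" for f
  proof (rule smooth_local)
    fix p
    obtain W Y where "open W" "p \<in> W" "Y \<in> vector_fields A" "\<forall>q\<in>W. X q = Y q"
      using assms by blast
    then show "\<exists>W h. open W \<and> p \<in> W \<and> h \<in> smooth_functions A \<and> (\<forall>q\<in>W. vf_deriv X f q = h q)"
      using vector_fieldD(2)[OF _ f]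
      by (intro exI[of _ W] exI[of _ "vf_deriv Y f"]) (simp add: vf_deriv_def)
  qed
  ultimately show ?thesis by (simp add: vector_fields_def)
qed

lemma tangent_vector_extends:
  assumes "v \<in> tangent_space A p"
  obtains X where "X \<in> vector_fields A" "X p = v"
proof -
  obtain W E c where W: "p \<in> W" and fr: "local_frame A W E c" by (rule local_frame_exists)
  define X where "X = (\<lambda>q f. \<Sum>i\<in>UNIV. v (c i) * E i q f)"
  have "X \<in> vector_fields A"
    unfolding X_def by (rule combination_vector_field) (use fr smooth_const in \<open>auto simp: local_frame_def\<close>)
  moreover have "X p f = v f" for f
    using fr W assms unfolding local_frame_def X_def by simp
  ultimately show thesis using that by blast
qed

section \<open>Tensoriality\<close>

text \<open>Maps from vector fields to functions that are linear over the smooth functions. They turn out to be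
  the 1-forms; the formulation in terms of sections is the one in which the Koszul expression and the
  Lie derivative of the metric present themselves.\<close>

definition smooth_linear :: "('a vfield \<Rightarrow> 'a \<Rightarrow> real) \<Rightarrow> bool" where
  "smooth_linear \<omega> \<longleftrightarrow> (\<forall>X\<in>vector_fields A. \<omega> X \<in> smooth_functions A) \<and>
     (\<forall>X\<in>vector_fields A. \<forall>Y\<in>vector_fields A. \<forall>f\<in>smooth_functions A. \<forall>h\<in>smooth_functions A. \<forall>p.
        \<omega> (vf_comb f X h Y) p = f p * \<omega> X p + h p * \<omega> Y p)"

lemma smooth_linear_scale:
  assumes "smooth_linear \<omega>"
  shows "smooth_linear (\<lambda>X p. a * \<omega> X p)"
proof -
  have "(\<lambda>p. a * \<omega> X p) \<in> smooth_functions A" if "X \<in> vector_fields A" for X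
    using assms that by (intro smooth_mult smooth_const) (simp add: smooth_linear_def)
  then show ?thesis
    using assms by (simp add: smooth_linear_def distrib_left mult.left_commute)
qed

lemma smooth_linear_combination:
  assumes \<omega>: "smooth_linear \<omega>" and "finite I"
    and "\<And>i. i \<in> I \<Longrightarrow> X i \<in> vector_fields A" "\<And>i. i \<in> I \<Longrightarrow> k i \<in> smooth_functions A"
  shows "\<omega> (\<lambda>p f. \<Sum>i\<in>I. k i p * X i p f) p = (\<Sum>i\<in>I. k i p * \<omega> (X i) p)"
  using assms(2-4)
proof (induction I)
  case empty
  have "\<omega> (vf_comb (\<lambda>p. 0) (\<lambda>p f. 0) (\<lambda>p. 0) (\<lambda>p f. 0)) p = 0"
    using \<omega> zero_vector_field smooth_const by (simp add: smooth_linear_def)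
  then show ?case by (simp add: vf_comb_def lincomb_def)
next
  case (insert i I)
  let ?Y = "\<lambda>p f. \<Sum>i\<in>I. k i p * X i p f"
  have "(\<lambda>p f. \<Sum>i\<in>insert i I. k i p * X i p f) = vf_comb (k i) (X i) (\<lambda>p. 1) ?Y"
    using insert.hyps by (simp add: vf_comb_def lincomb_def)
  moreover have "?Y \<in> vector_fields A"
    using insert.prems by (intro combination_vector_field) auto
  ultimately have "\<omega> (\<lambda>p f. \<Sum>i\<in>insert i I. k i p * X i p f) p = k i p * \<omega> (X i) p + 1 * \<omega> ?Y p"
    using \<omega> insert.prems smooth_const by (simp add: smooth_linear_def)
  then show ?case using insert by simp
qed

text \<open>With a bump function \<open>b\<close> supported in \<open>W\<close> and \<open>b q = 1\<close>, the frame expansion of \<open>b X\<close> holds on the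
  whole manifold, so linearity over the smooth functions applies to it.\<close>

lemma smooth_linear_in_frame:
  assumes \<omega>: "smooth_linear \<omega>" and fr: "local_frame A W E c" and q: "q \<in> W" and X: "X \<in> vector_fields A"
  shows "\<omega> X q = (\<Sum>i\<in>UNIV. X q (c i) * \<omega> (E i) q)"
proof -
  have W: "open W" and E: "E i \<in> vector_fields A" and c: "c i \<in> smooth_functions A" for i
    using fr by (auto simp: local_frame_def)
  obtain b W' where b: "b \<in> smooth_functions A" "q \<in> W'" "\<And>q. q \<in> W' \<Longrightarrow> b q = 1"
    "\<And>q. q \<notin> W \<Longrightarrow> b q = 0"
    using bump[OF W q] by metis
  have bX: "vf_comb b X (\<lambda>p. 0) X = (\<lambda>p f. \<Sum>i\<in>UNIV. (b p * vf_deriv X (c i) p) * E i p f)"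
  proof (intro ext)
    fix p f
    have "b p * X p f = b p * (\<Sum>i\<in>UNIV. X p (c i) * E i p f)"
    proof (cases "p \<in> W")
      case True
      then have "X p f = (\<Sum>i\<in>UNIV. X p (c i) * E i p f)"
        using fr vector_fieldD(1)[OF X, of p] unfolding local_frame_def by blast
      then show ?thesis by simp
    qed (simp add: b(4))
    then show "vf_comb b X (\<lambda>p. 0) X p f = (\<Sum>i\<in>UNIV. (b p * vf_deriv X (c i) p) * E i p f)"
      by (simp add: vf_comb_def lincomb_def vf_deriv_def sum_distrib_left mult.assoc)
  qed
  have "\<omega> X q = \<omega> (vf_comb b X (\<lambda>p. 0) X) q"
    using \<omega> X b smooth_const by (simp add: smooth_linear_def)
  also have "\<dots> = (\<Sum>i\<in>UNIV. (b q * vf_deriv X (c i) q) * \<omega> (E i) q)"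
    unfolding bX
    by (rule smooth_linear_combination[OF \<omega>])
      (auto intro: E smooth_mult b(1) vector_fieldD(2)[OF X] c)
  finally show ?thesis using b(2,3) by (simp add: vf_deriv_def)
qed

lemma smooth_linear_tensorial:
  assumes "smooth_linear \<omega>" "X \<in> vector_fields A" "Y \<in> vector_fields A" "X p = Y p"
  shows "\<omega> X p = \<omega> Y p"
proof -
  obtain W E c where W: "p \<in> W" and fr: "local_frame A W E c" by (rule local_frame_exists)
  show ?thesis
    using smooth_linear_in_frame[OF assms(1) fr W] assms(2-4) by simp
qed

lemma linear_form_combination:
  assumes "linear_form_on (tangent_space A p) \<alpha>" "finite I" "\<And>i. i \<in> I \<Longrightarrow> v i \<in> tangent_space A p"
  shows "\<alpha> (\<lambda>f. \<Sum>i\<in>I. a i * v i f) = (\<Sum>i\<in>I. a i * \<alpha> (v i))"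
  using assms(2,3)
proof (induction I)
  case empty
  have "(\<lambda>f. 0) \<in> tangent_space A p" using tangent_combination[of "{}"] by simp
  then have "\<alpha> (lincomb 0 (\<lambda>f. 0) 0 (\<lambda>f. 0)) = 0"
    using assms(1) by (simp add: linear_form_on_def)
  then show ?case by (simp add: lincomb_def)
next
  case (insert i I)
  let ?w = "\<lambda>f. \<Sum>i\<in>I. a i * v i f"
  have "(\<lambda>f. \<Sum>i\<in>insert i I. a i * v i f) = lincomb (a i) (v i) 1 ?w"
    using insert.hyps by (simp add: lincomb_def)
  moreover have "?w \<in> tangent_space A p"
    using insert.prems by (intro tangent_combination) auto
  ultimately have "\<alpha> (\<lambda>f. \<Sum>i\<in>insert i I. a i * v i f) = a i * \<alpha> (v i) + 1 * \<alpha> ?w"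
    using assms(1) insert.prems by (simp add: linear_form_on_def)
  then show ?case using insert by simp
qed

text \<open>Near \<open>p\<close> the reciprocal is \<open>D / D\<^sup>2\<close>. Adding \<open>1 - b\<close> to the denominator, with a bump function \<open>b\<close>
  supported where \<open>D \<noteq> 0\<close>, makes it positive everywhere without changing it near \<open>p\<close>.\<close>

lemma smooth_local_reciprocal:
  assumes D: "D \<in> smooth_functions A" and W: "open W" "p \<in> W" and nz: "\<And>q. q \<in> W \<Longrightarrow> D q \<noteq> 0"
  obtains k W' where "k \<in> smooth_functions A" "open W'" "p \<in> W'" "W' \<subseteq> W" "\<And>q. q \<in> W' \<Longrightarrow> k q * D q = 1"
proof -
  obtain b W' where b: "b \<in> smooth_functions A" "open W'" "p \<in> W'" "\<And>q. q \<in> W' \<Longrightarrow> b q = 1"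
    "\<And>q. q \<notin> W \<Longrightarrow> b q = 0" "\<And>q. 0 \<le> b q" "\<And>q. b q \<le> 1"
    using bump[OF W] by metis
  define k where "k q = D q * inverse (D q * D q + (1 - b q))" for q
  have "D q * D q + (1 - b q) \<noteq> 0" for q
  proof (cases "q \<in> W")
    case True
    then have "D q * D q > 0" using nz not_real_square_gt_zero[of "D q"] by blast
    then show ?thesis using b(7)[of q] by linarith
  next
    case False
    then show ?thesis using b(5)[of q] zero_le_square[of "D q"] by linarith
  qed
  then have "k \<in> smooth_functions A"
    unfolding k_def by (intro smooth_mult smooth_inverse smooth_add smooth_diff smooth_const D b(1))
  moreover have "k q * D q = 1" if "q \<in> W'" for q
  proof -
    have "q \<in> W" using b(4)[OF that] b(5)[of q] by auto
    then show ?thesis using nz b(4)[OF that] by (simp add: k_def field_simps)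
  qed
  moreover have "W' \<subseteq> W" using b(4,5) by force
  ultimately show thesis using that b(2,3) by blast
qed

lemma smooth_det:
  assumes "\<And>i j. (\<lambda>q. M q $ i $ j) \<in> smooth_functions A"
  shows "(\<lambda>q. det (M q :: real ^ 'm ^ 'm)) \<in> smooth_functions A"
  unfolding det_def by (intro smooth_sum smooth_mult smooth_const smooth_prod assms)

end

section \<open>The musical isomorphism of a pseudo-Riemannian metric\<close>

locale pseudo_riemannian_manifold = smooth_manifold A
  for A :: "('a::{t2_space, second_countable_topology}, 'n::finite) chart set" +
  fixes g :: "'a \<Rightarrow> 'a tvec \<Rightarrow> 'a tvec \<Rightarrow> real"
  assumes metric: "pseudo_riemannian_metric A g"
begin

abbreviation G :: "'a vfield \<Rightarrow> 'a vfield \<Rightarrow> 'a \<Rightarrow> real" where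
  "G \<equiv> metric_app g"

lemma g_linear: "v \<in> tangent_space A p \<Longrightarrow> linear_form_on (tangent_space A p) (g p v)"
  using metric by (simp add: pseudo_riemannian_metric_def)

lemma g_sym: "v \<in> tangent_space A p \<Longrightarrow> w \<in> tangent_space A p \<Longrightarrow> g p v w = g p w v"
  using metric unfolding pseudo_riemannian_metric_def by blast

lemma g_nondegenerate:
  "v \<in> tangent_space A p \<Longrightarrow> (\<And>w. w \<in> tangent_space A p \<Longrightarrow> g p v w = 0) \<Longrightarrow> v = zero_tvec"
  using metric unfolding pseudo_riemannian_metric_def by blast

lemma g_lincomb:
  assumes "u \<in> tangent_space A p" "v \<in> tangent_space A p" "w \<in> tangent_space A p"
  shows "g p u (lincomb a v b w) = a * g p u v + b * g p u w"
    and "g p (lincomb a v b w) u = a * g p v u + b * g p w u"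
  using g_linear assms g_sym lincomb_tangent unfolding linear_form_on_def by auto

text \<open>Nondegeneracy in terms of fields; it rests on the fact that every tangent vector extends to a global field.\<close>

lemma g_determined:
  assumes "v \<in> tangent_space A p" "w \<in> tangent_space A p"
    and "\<And>Z. Z \<in> vector_fields A \<Longrightarrow> g p v (Z p) = g p w (Z p)"
  shows "v = w"
proof -
  have "lincomb 1 v (-1) w = zero_tvec"
  proof (rule g_nondegenerate[OF lincomb_tangent[OF assms(1,2)]])
    fix z assume z: "z \<in> tangent_space A p"
    then obtain Z where "Z \<in> vector_fields A" "Z p = z" by (rule tangent_vector_extends)
    then show "g p (lincomb 1 v (-1) w) z = 0"
      using assms(3)[of Z] g_lincomb(2)[OF z assms(1,2)] by simp
  qed
  then show ?thesis by (simp add: lincomb_def zero_tvec_def fun_eq_iff)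
qed

lemma G_smooth: "X \<in> vector_fields A \<Longrightarrow> Y \<in> vector_fields A \<Longrightarrow> G X Y \<in> smooth_functions A"
  using metric by (simp add: pseudo_riemannian_metric_def)

lemma G_sym: "X \<in> vector_fields A \<Longrightarrow> Y \<in> vector_fields A \<Longrightarrow> G X Y = G Y X"
  using g_sym vector_fieldD(1) by (auto simp: metric_app_def)

lemma G_comb:
  assumes "X \<in> vector_fields A" "Y \<in> vector_fields A" "Z \<in> vector_fields A"
  shows "G Z (vf_comb f X h Y) = (\<lambda>p. f p * G Z X p + h p * G Z Y p)"
    and "G (vf_comb f X h Y) Z = (\<lambda>p. f p * G X Z p + h p * G Y Z p)"
  using assms g_lincomb vector_fieldD(1) by (auto simp: metric_app_def vf_comb_def)

lemma G_smooth_linear: "X \<in> vector_fields A \<Longrightarrow> smooth_linear (G X)"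
  by (simp add: smooth_linear_def G_smooth G_comb)

text \<open>A vector in the kernel of the Gram matrix gives the coefficients of a tangent vector orthogonal to the
  whole frame, hence zero by nondegeneracy; the dual coframe recovers the coefficients.\<close>

lemma gram_det_nonzero:
  assumes fr: "local_frame A W E c" and q: "q \<in> W"
  shows "det (\<chi> i j. G (E i) (E j) q) \<noteq> 0"
proof -
  have E: "E i \<in> vector_fields A" for i using fr by (auto simp: local_frame_def)
  note Eq = vector_fieldD(1)[OF E, of _ q]
  let ?M = "\<chi> i j. G (E i) (E j) q"
  have "x = 0" if x: "?M *v x = 0" for x
  proof -
    define v where "v = (\<lambda>f. \<Sum>j\<in>UNIV. x $ j * E j q f)"
    have v: "v \<in> tangent_space A q"
      unfolding v_def by (rule tangent_combination[OF Eq])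
    have vE: "g q v (E i q) = 0" for i
    proof -
      have "g q v (E i q) = g q (E i q) v" by (rule g_sym[OF v Eq])
      also have "\<dots> = (\<Sum>j\<in>UNIV. x $ j * g q (E i q) (E j q))"
        unfolding v_def by (rule linear_form_combination[OF g_linear[OF Eq] finite Eq])
      also have "\<dots> = (?M *v x) $ i"
        by (simp add: matrix_vector_mult_def metric_app_def mult.commute)
      finally show ?thesis using x by simp
    qed
    have "v = zero_tvec"
    proof (rule g_nondegenerate[OF v])
      fix w assume w: "w \<in> tangent_space A q"
      then have "w = (\<lambda>f. \<Sum>i\<in>UNIV. w (c i) * E i q f)"
        using fr q by (auto simp: local_frame_def)
      then have "g q v w = g q v (\<lambda>f. \<Sum>i\<in>UNIV. w (c i) * E i q f)" by simp
      also have "\<dots> = (\<Sum>i\<in>UNIV. w (c i) * g q v (E i q))"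
        by (rule linear_form_combination[OF g_linear[OF v] finite Eq])
      finally show "g q v w = 0" using vE by simp
    qed
    then have "v (c j) = 0" for j by (simp add: zero_tvec_def)
    moreover have "v (c j) = x $ j" for j
    proof -
      have "v (c j) = (\<Sum>i\<in>UNIV. x $ i * (if i = j then 1 else 0))"
        using fr q by (simp add: v_def local_frame_def)
      then show ?thesis by (simp add: if_distrib cong: if_cong)
    qed
    ultimately show "x = 0" by (simp add: vec_eq_iff)
  qed
  then show ?thesis
    by (simp add: invertible_det_nz[symmetric] invertible_left_inverse matrix_left_invertible_ker)
qed

text \<open>In a local frame the representing field solves a linear system with the Gram matrix. Cramer's rule
  gives its coefficients as polynomials in smooth functions divided by the Gram determinant.\<close>

lemma representing_field_local:
  assumes \<omega>: "smooth_linear \<omega>"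
  shows "\<exists>W Y. open W \<and> p \<in> W \<and> Y \<in> vector_fields A \<and>
    (\<forall>q\<in>W. \<forall>Z\<in>vector_fields A. G Y Z q = \<omega> Z q)"
proof -
  obtain W E c where pW: "p \<in> W" and fr: "local_frame A W E c" by (rule local_frame_exists)
  have W: "open W" and E: "E i \<in> vector_fields A" for i
    using fr by (auto simp: local_frame_def)
  define M where "M q = (\<chi> i j. G (E i) (E j) q)" for q
  define D where "D q = det (M q)" for q
  define R where "R k q = det (\<chi> i j. if j = k then \<omega> (E i) q else M q $ i $ j)" for k q
  have "D \<in> smooth_functions A"
    unfolding D_def[abs_def] by (rule smooth_det) (simp add: M_def G_smooth E)
  moreover have nz: "D q \<noteq> 0" if "q \<in> W" for q
    unfolding D_def M_def by (rule gram_det_nonzero[OF fr that])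
  ultimately obtain r W' where r: "r \<in> smooth_functions A" and W': "open W'" "p \<in> W'" "W' \<subseteq> W"
    and rD: "\<And>q. q \<in> W' \<Longrightarrow> r q * D q = 1"
    using smooth_local_reciprocal[OF _ W pW] by metis
  have R: "R k \<in> smooth_functions A" for k
    unfolding R_def[abs_def]
  proof (rule smooth_det)
    have "\<omega> (E i) \<in> smooth_functions A" for i using \<omega> E by (simp add: smooth_linear_def)
    then show "(\<lambda>q. (\<chi> i j. if j = k then \<omega> (E i) q else M q $ i $ j) $ i $ j) \<in> smooth_functions A" for i j
      by (cases "j = k") (simp_all add: M_def G_smooth E)
  qed
  define Y where "Y = (\<lambda>q f. \<Sum>k\<in>UNIV. (R k q * r q) * E k q f)"
  have Y: "Y \<in> vector_fields A"
    unfolding Y_def by (intro combination_vector_field E smooth_mult R r)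
  have "G Y Z q = \<omega> Z q" if q: "q \<in> W'" and Z: "Z \<in> vector_fields A" for q Z
  proof -
    have qW: "q \<in> W" using q W'(3) by blast
    have recip: "r q = 1 / det (M q)"
      using rD[OF q] nz[OF qW] by (simp add: D_def field_simps)
    have "M q *v (\<chi> k. R k q * r q) = (\<chi> i. \<omega> (E i) q)"
      using nz[OF qW] unfolding D_def
      by (subst cramer) (simp_all add: recip R_def vec_eq_iff cong: if_cong)
    then have sol: "(\<Sum>k\<in>UNIV. M q $ i $ k * (R k q * r q)) = \<omega> (E i) q" for i
      by (simp add: matrix_vector_mult_def vec_eq_iff)
    have "G Y (E i) q = \<omega> (E i) q" for i
    proof -
      have "G Y (E i) q = G (E i) Y q" using G_sym[OF Y E] by simp
      also have "\<dots> = (\<Sum>k\<in>UNIV. (R k q * r q) * G (E i) (E k) q)"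
        unfolding Y_def
        by (rule smooth_linear_combination[OF G_smooth_linear[OF E] finite E]) (intro smooth_mult R r)
      finally show ?thesis using sol[of i] by (simp add: M_def mult.commute)
    qed
    then show ?thesis
      using smooth_linear_in_frame[OF G_smooth_linear[OF Y] fr qW Z] smooth_linear_in_frame[OF \<omega> fr qW Z]
      by simp
  qed
  then show ?thesis using W' Y by blast
qed

text \<open>The local solutions agree wherever both represent \<open>\<omega>\<close>, by nondegeneracy, so their values at the
  centres of their domains glue to a field.\<close>

lemma representing_field:
  assumes \<omega>: "smooth_linear \<omega>"
  obtains Y where "Y \<in> vector_fields A" "\<And>Z. Z \<in> vector_fields A \<Longrightarrow> G Y Z = \<omega> Z"
proof -
  obtain W Y where WY: "\<And>p. open (W p) \<and> p \<in> W p \<and> Y p \<in> vector_fields A \<and>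
      (\<forall>q\<in>W p. \<forall>Z\<in>vector_fields A. G (Y p) Z q = \<omega> Z q)"
    using representing_field_local[OF \<omega>] by metis
  have "Y q q = Y p q" if "q \<in> W p" for p q
  proof (rule g_determined)
    show "Y q q \<in> tangent_space A q" "Y p q \<in> tangent_space A q"
      using WY vector_fieldD(1) by blast+
    show "g q (Y q q) (Z q) = g q (Y p q) (Z q)" if "Z \<in> vector_fields A" for Z
      using WY[of p] WY[of q] that \<open>q \<in> W p\<close> by (simp add: metric_app_def)
  qed
  then have "(\<lambda>p. Y p p) \<in> vector_fields A"
    using WY by (intro vector_field_local) metis
  moreover have "G (\<lambda>p. Y p p) Z = \<omega> Z" if "Z \<in> vector_fields A" for Z
  proof
    show "G (\<lambda>p. Y p p) Z p = \<omega> Z p" for p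
      using WY[of p] that by (simp add: metric_app_def)
  qed
  ultimately show thesis by (rule that)
qed

end

section \<open>The Koszul formula\<close>

context smooth_manifold
begin

lemma vf_deriv_comb:
  assumes "V \<in> vector_fields A" "f \<in> smooth_functions A" "a \<in> smooth_functions A"
    and "h \<in> smooth_functions A" "b \<in> smooth_functions A"
  shows "vf_deriv V (\<lambda>p. f p * a p + h p * b p) p
    = vf_deriv V f p * a p + f p * vf_deriv V a p + (vf_deriv V h p * b p + h p * vf_deriv V b p)"
proof -
  note v = vector_fieldD(1)[OF assms(1), of p]
  show ?thesis
    unfolding vf_deriv_def tangent_add[OF v smooth_mult[OF assms(2,3)] smooth_mult[OF assms(4,5)]]
      tangent_mult[OF v assms(2,3)] tangent_mult[OF v assms(4,5)] ..
qed

lemma vf_comb_deriv: "vf_deriv (vf_comb f X h Y) F p = f p * vf_deriv X F p + h p * vf_deriv Y F p"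
  by (simp add: vf_deriv_def vf_comb_def lincomb_def)

lemma vf_deriv_const: "V \<in> vector_fields A \<Longrightarrow> vf_deriv V (\<lambda>p. c) p = 0"
  by (simp add: vf_deriv_def tangent_const[OF vector_fieldD(1)])

text \<open>Tangent vectors are 0 on nonsmooth functions, so they only need to be compared on smooth ones.\<close>

lemma vector_field_eqI:
  assumes "X \<in> vector_fields A" "Y \<in> vector_fields A"
    and "\<And>p f. f \<in> smooth_functions A \<Longrightarrow> X p f = Y p f"
  shows "X = Y"
proof (intro ext)
  show "X p f = Y p f" for p f
    using assms(3) tangent_nonsmooth[OF vector_fieldD(1)[OF assms(1)]]
      tangent_nonsmooth[OF vector_fieldD(1)[OF assms(2)]] by (cases "f \<in> smooth_functions A") simp_all
qed

lemma lie_bracket_comb: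
  assumes X: "X \<in> vector_fields A" and Y: "Y \<in> vector_fields A" and Z: "Z \<in> vector_fields A"
    and f: "f \<in> smooth_functions A" and h: "h \<in> smooth_functions A"
  shows "lie_bracket X (vf_comb f Y h Z)
    = vf_comb (\<lambda>p. 1) (vf_comb f (lie_bracket X Y) (vf_deriv X f) Y)
        (\<lambda>p. 1) (vf_comb h (lie_bracket X Z) (vf_deriv X h) Z)"
proof (rule vector_field_eqI)
  show "lie_bracket X (vf_comb f Y h Z) \<in> vector_fields A"
    by (intro lie_bracket_vector_field vf_comb_vector_field assms)
  show "vf_comb (\<lambda>p. 1) (vf_comb f (lie_bracket X Y) (vf_deriv X f) Y)
      (\<lambda>p. 1) (vf_comb h (lie_bracket X Z) (vf_deriv X h) Z) \<in> vector_fields A"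
    by (intro vf_comb_vector_field lie_bracket_vector_field vector_fieldD(2)[OF X] smooth_const assms)
  fix p F assume F: "F \<in> smooth_functions A"
  have "vf_deriv (vf_comb f Y h Z) F = (\<lambda>p. f p * vf_deriv Y F p + h p * vf_deriv Z F p)"
    by (rule ext) (rule vf_comb_deriv)
  then have "X p (vf_deriv (vf_comb f Y h Z) F)
    = vf_deriv X f p * vf_deriv Y F p + f p * vf_deriv X (vf_deriv Y F) p
      + (vf_deriv X h p * vf_deriv Z F p + h p * vf_deriv X (vf_deriv Z F) p)"
    using vf_deriv_comb[OF X f vector_fieldD(2)[OF Y F] h vector_fieldD(2)[OF Z F], of p]
    by (simp add: vf_deriv_def[of X])
  then show "lie_bracket X (vf_comb f Y h Z) p F
    = vf_comb (\<lambda>p. 1) (vf_comb f (lie_bracket X Y) (vf_deriv X f) Y)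
        (\<lambda>p. 1) (vf_comb h (lie_bracket X Z) (vf_deriv X h) Z) p F"
    unfolding lie_bracket_def by (simp add: vf_comb_def lincomb_def vf_deriv_def algebra_simps)
qed

lemma lie_bracket_swap: "lie_bracket Y X = vf_comb (\<lambda>p. - 1) (lie_bracket X Y) (\<lambda>p. 0) (lie_bracket X Y)"
  by (simp add: lie_bracket_def vf_comb_def lincomb_def)

end

context pseudo_riemannian_manifold
begin

lemma G_bracket_swap:
  assumes "X \<in> vector_fields A" "Y \<in> vector_fields A" "V \<in> vector_fields A"
  shows "G (lie_bracket Y X) V p = - G (lie_bracket X Y) V p"
  unfolding lie_bracket_swap[of Y X]
  using G_comb(2)[OF lie_bracket_vector_field lie_bracket_vector_field assms(3)] assms by simp

lemma G_bracket_comb: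
  assumes "X \<in> vector_fields A" "Y \<in> vector_fields A" "Z \<in> vector_fields A" "V \<in> vector_fields A"
    and "f \<in> smooth_functions A" "h \<in> smooth_functions A"
  shows "G (lie_bracket X (vf_comb f Y h Z)) V p
    = f p * G (lie_bracket X Y) V p + vf_deriv X f p * G Y V p
      + (h p * G (lie_bracket X Z) V p + vf_deriv X h p * G Z V p)"
  unfolding lie_bracket_comb[OF assms(1-3,5,6)]
  using assms
  by (simp add: G_comb vf_comb_vector_field lie_bracket_vector_field vector_fieldD(2))

text \<open>The right-hand side of the Koszul formula for the Levi-Civita connection on the tangent bundle. On the
  contact distribution it also describes the intrinsic connection: replacing the brackets by their
  projections does not change their products with fields of the distribution.\<close>

definition koszul :: "'a vfield \<Rightarrow> 'a vfield \<Rightarrow> 'a vfield \<Rightarrow> 'a \<Rightarrow> real" where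
  "koszul X Y Z = (\<lambda>p. 1 / 2 * (vf_deriv X (G Y Z) p + vf_deriv Y (G Z X) p - vf_deriv Z (G X Y) p
     + G (lie_bracket X Y) Z p - G (lie_bracket Y Z) X p + G (lie_bracket Z X) Y p))"

text \<open>The derivatives of the coefficients produced by the first two terms cancel against those
  produced by the last two brackets.\<close>

lemma koszul_comb_right:
  assumes X: "X \<in> vector_fields A" and Y: "Y \<in> vector_fields A" and Z: "Z \<in> vector_fields A"
    and W: "W \<in> vector_fields A" and f: "f \<in> smooth_functions A" and h: "h \<in> smooth_functions A"
  shows "koszul X Y (vf_comb f Z h W) p = f p * koszul X Y Z p + h p * koszul X Y W p"
proof -
  note [simp] = assms vf_comb_vector_field lie_bracket_vector_field G_smooth
  show ?thesis
    unfolding koszul_def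
    by (simp add: G_comb vf_comb_deriv vf_deriv_comb G_bracket_comb G_bracket_swap[of X _ Y]
        G_sym[of Z Y] G_sym[of W Y]) (simp add: field_simps)
qed

lemma koszul_comb_left:
  assumes X: "X \<in> vector_fields A" and Y: "Y \<in> vector_fields A" and Z: "Z \<in> vector_fields A"
    and W: "W \<in> vector_fields A" and f: "f \<in> smooth_functions A" and h: "h \<in> smooth_functions A"
  shows "koszul (vf_comb f X h W) Y Z p = f p * koszul X Y Z p + h p * koszul W Y Z p"
proof -
  note [simp] = assms vf_comb_vector_field lie_bracket_vector_field G_smooth
  show ?thesis
    unfolding koszul_def
    by (simp add: G_comb vf_comb_deriv vf_deriv_comb G_bracket_comb G_bracket_swap[of Y _ Z]
        G_sym[of Z X] G_sym[of Z W]) (simp add: field_simps)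
qed

text \<open>Here the terms with derivatives of the coefficients do not cancel: they give the Leibniz rule.\<close>

lemma koszul_comb_middle:
  assumes X: "X \<in> vector_fields A" and Y: "Y \<in> vector_fields A" and Z: "Z \<in> vector_fields A"
    and W: "W \<in> vector_fields A" and f: "f \<in> smooth_functions A" and h: "h \<in> smooth_functions A"
  shows "koszul X (vf_comb f Y h W) Z p
    = f p * koszul X Y Z p + h p * koszul X W Z p + vf_deriv X f p * G Y Z p + vf_deriv X h p * G W Z p"
proof -
  note [simp] = assms vf_comb_vector_field lie_bracket_vector_field G_smooth
  show ?thesis
    unfolding koszul_def
    by (simp add: G_comb vf_comb_deriv vf_deriv_comb G_bracket_comb G_bracket_swap[of Z _ X]
        G_sym[of X Y] G_sym[of X W]) (simp add: field_simps)
qed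

lemma koszul_smooth_linear:
  assumes "X \<in> vector_fields A" "Y \<in> vector_fields A"
  shows "smooth_linear (koszul X Y)"
proof -
  have "koszul X Y Z \<in> smooth_functions A" if "Z \<in> vector_fields A" for Z
    unfolding koszul_def
    by (intro smooth_mult smooth_const smooth_add smooth_diff vector_fieldD(2) G_smooth
        lie_bracket_vector_field that assms)
  then show ?thesis
    using assms by (simp add: smooth_linear_def koszul_comb_right)
qed

lemma koszul_metric:
  assumes "X \<in> vector_fields A" "Y \<in> vector_fields A" "Z \<in> vector_fields A"
  shows "koszul Z X Y p + koszul Z Y X p = vf_deriv Z (G X Y) p"
  unfolding koszul_def
  using G_bracket_swap[of X Y Z p] G_bracket_swap[of Z X Y p] G_bracket_swap[of Z Y X p]
    G_sym[of X Y] G_sym[of X Z] G_sym[of Y Z] assms by (simp add: field_simps)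

lemma koszul_torsion:
  assumes "X \<in> vector_fields A" "Y \<in> vector_fields A" "Z \<in> vector_fields A"
  shows "koszul X Y Z p - koszul Y X Z p = G (lie_bracket X Y) Z p"
  unfolding koszul_def
  using G_bracket_swap[of X Y Z p] G_bracket_swap[of Z X Y p] G_bracket_swap[of Z Y X p]
    G_sym[of X Y] G_sym[of X Z] G_sym[of Y Z] assms by (simp add: field_simps)

section \<open>The Lie derivative of the metric\<close>

lemma lie_deriv_metric_sym:
  assumes "\<xi> \<in> vector_fields A" "X \<in> vector_fields A" "Y \<in> vector_fields A"
  shows "lie_deriv_metric \<xi> g X Y = lie_deriv_metric \<xi> g Y X"
  using assms G_sym lie_bracket_vector_field by (simp add: lie_deriv_metric_def algebra_simps)

lemma lie_deriv_metric_smooth_linear: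
  assumes \<xi>: "\<xi> \<in> vector_fields A" and X: "X \<in> vector_fields A"
  shows "smooth_linear (lie_deriv_metric \<xi> g X)"
proof -
  have "lie_deriv_metric \<xi> g X Y \<in> smooth_functions A" if "Y \<in> vector_fields A" for Y
    unfolding lie_deriv_metric_def
    by (intro smooth_diff vector_fieldD(2) G_smooth lie_bracket_vector_field that assms)
  moreover have "lie_deriv_metric \<xi> g X (vf_comb f Y h Z) p
      = f p * lie_deriv_metric \<xi> g X Y p + h p * lie_deriv_metric \<xi> g X Z p"
    if "Y \<in> vector_fields A" "Z \<in> vector_fields A" "f \<in> smooth_functions A" "h \<in> smooth_functions A"
    for Y Z f h p
  proof -
    note [simp] = assms that vf_comb_vector_field lie_bracket_vector_field G_smooth
    show ?thesis
      unfolding lie_deriv_metric_def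
      by (simp add: G_comb vf_deriv_comb G_bracket_comb G_sym[of X "lie_bracket \<xi> _"] G_sym[of X Y] G_sym[of X Z])
        (simp add: algebra_simps)
  qed
  ultimately show ?thesis by (simp add: smooth_linear_def)
qed

end

section \<open>The contact distribution\<close>

sublocale almost_contact_metric_structure \<subseteq> pseudo_riemannian_manifold A g
  by unfold_locales (rule g_metric)

context almost_contact_metric_structure
begin

abbreviation \<Gamma>D :: "'a vfield set" where
  "\<Gamma>D \<equiv> admissible_fields A \<eta>"

lemma admissible_iff: "X \<in> \<Gamma>D \<longleftrightarrow> X \<in> vector_fields A \<and> (\<forall>p. \<eta> p (X p) = 0)"
  using vector_fieldD(1) by (auto simp: admissible_fields_def distribution_def)

lemma admissible_vector_field: "X \<in> \<Gamma>D \<Longrightarrow> X \<in> vector_fields A"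
  by (simp add: admissible_iff)

lemma eta_lincomb:
  assumes "v \<in> tangent_space A p" "w \<in> tangent_space A p"
  shows "\<eta> p (lincomb a v b w) = a * \<eta> p v + b * \<eta> p w"
  using eta_form assms by (auto simp: one_form_def linear_form_on_def)

lemma admissible_comb:
  assumes "X \<in> \<Gamma>D" "Y \<in> \<Gamma>D" "f \<in> smooth_functions A" "h \<in> smooth_functions A"
  shows "vf_comb f X h Y \<in> \<Gamma>D"
proof -
  have X: "X \<in> vector_fields A" "\<And>p. \<eta> p (X p) = 0" and Y: "Y \<in> vector_fields A" "\<And>p. \<eta> p (Y p) = 0"
    using assms(1,2) by (auto simp: admissible_iff)
  have "\<eta> p (vf_comb f X h Y p) = 0" for p
    unfolding vf_comb_def eta_lincomb[OF vector_fieldD(1)[OF X(1)] vector_fieldD(1)[OF Y(1)]]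
    using X(2) Y(2) by simp
  then show ?thesis
    by (simp add: admissible_iff vf_comb_vector_field X(1) Y(1) assms(3,4))
qed

text \<open>Take \<open>Y = \<xi>\<close> in the compatibility of \<open>g\<close> with \<open>\<phi>\<close>: the left-hand side vanishes since \<open>\<phi>(\<xi>) = 0\<close>.
  Thus \<open>\<xi>\<close> is orthogonal to the distribution, which makes \<open>g\<close> nondegenerate on it.\<close>

lemma G_xi:
  assumes X: "X \<in> vector_fields A"
  shows "G X \<xi> p = \<eta> p (X p)"
proof -
  have "endo_app \<phi> X \<in> vector_fields A"
    using phi_tensor X by (simp add: tensor_field_11_def)
  then have phiX: "\<phi> p (X p) \<in> tangent_space A p"
    using vector_fieldD(1) by (fastforce simp: endo_app_def)
  have "g p (\<phi> p (X p)) zero_tvec = 0"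
    using g_lincomb(1)[OF phiX phiX phiX, of 0 0] by (simp add: lincomb_def zero_tvec_def)
  then show ?thesis
    using g_phi[OF X xi_field, of p] by (simp add: phi_xi eta_xi metric_app_def)
qed

lemma proj_D_eq: "proj_D \<xi> \<eta> X = vf_comb (\<lambda>p. 1) X (\<lambda>p. - \<eta> p (X p)) \<xi>"
  by (simp add: proj_D_def vf_comb_def)

lemma eta_smooth: "X \<in> vector_fields A \<Longrightarrow> (\<lambda>p. \<eta> p (X p)) \<in> smooth_functions A"
  using eta_form by (simp add: one_form_def form_app_def)

lemma proj_D_admissible:
  assumes X: "X \<in> vector_fields A"
  shows "proj_D \<xi> \<eta> X \<in> \<Gamma>D"
proof -
  have "proj_D \<xi> \<eta> X \<in> vector_fields A"
    unfolding proj_D_eq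
    by (intro vf_comb_vector_field X xi_field smooth_const smooth_minus eta_smooth)
  moreover have "\<eta> p (proj_D \<xi> \<eta> X p) = 0" for p
    unfolding proj_D_def eta_lincomb[OF vector_fieldD(1)[OF X] vector_fieldD(1)[OF xi_field]]
    by (simp add: eta_xi)
  ultimately show ?thesis by (simp add: admissible_iff)
qed

lemma G_proj_D:
  assumes X: "X \<in> vector_fields A" and Y: "Y \<in> \<Gamma>D"
  shows "G (proj_D \<xi> \<eta> X) Y p = G X Y p"
proof -
  have "G \<xi> Y p = 0"
    using G_xi[of Y p] G_sym[of \<xi> Y] xi_field Y by (simp add: admissible_iff)
  then show ?thesis
    unfolding proj_D_eq G_comb(2)[OF X xi_field admissible_vector_field[OF Y]] by simp
qed

lemma distribution_vector_extends:
  assumes "v \<in> distribution A \<eta> p"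
  obtains X where "X \<in> \<Gamma>D" "X p = v"
proof -
  obtain Y where Y: "Y \<in> vector_fields A" "Y p = v"
    using tangent_vector_extends assms by (metis (no_types, lifting) distribution_def mem_Collect_eq)
  have "proj_D \<xi> \<eta> Y p = v"
    using assms Y(2) by (simp add: proj_D_def distribution_def lincomb_def)
  then show thesis using that proj_D_admissible[OF Y(1)] by blast
qed

text \<open>Projecting a test field to the distribution does not change its product with a vector of the
  distribution, so testing against admissible fields is as good as testing against all fields.\<close>

lemma g_determined_on_distribution:
  assumes v: "v \<in> distribution A \<eta> p" and w: "w \<in> distribution A \<eta> p"
    and eq: "\<And>Z. Z \<in> \<Gamma>D \<Longrightarrow> g p v (Z p) = g p w (Z p)"
  shows "v = w"
proof -
  obtain V where V: "V \<in> \<Gamma>D" "V p = v" using v by (rule distribution_vector_extends)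
  obtain W where W: "W \<in> \<Gamma>D" "W p = w" using w by (rule distribution_vector_extends)
  show ?thesis
  proof (rule g_determined)
    show "v \<in> tangent_space A p" "w \<in> tangent_space A p"
      using v w by (auto simp: distribution_def)
    fix Z assume Z: "Z \<in> vector_fields A"
    have "G V Z p = G V (proj_D \<xi> \<eta> Z) p" "G W Z p = G W (proj_D \<xi> \<eta> Z) p"
      using G_proj_D[OF Z V(1)] G_proj_D[OF Z W(1)] G_sym V(1) W(1) Z
        proj_D_admissible[OF Z] admissible_vector_field by simp_all
    then show "g p v (Z p) = g p w (Z p)"
      using eq[OF proj_D_admissible[OF Z]] V(2) W(2) by (simp add: metric_app_def)
  qed
qed

lemma admissible_at: "X \<in> \<Gamma>D \<Longrightarrow> X p \<in> distribution A \<eta> p"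
  by (simp add: admissible_fields_def)

lemma admissible_eqI:
  assumes X: "X \<in> \<Gamma>D" and Y: "Y \<in> \<Gamma>D" and eq: "\<And>Z p. Z \<in> \<Gamma>D \<Longrightarrow> G X Z p = G Y Z p"
  shows "X = Y"
proof
  show "X p = Y p" for p
    by (rule g_determined_on_distribution[OF admissible_at[OF X] admissible_at[OF Y]])
      (use eq in \<open>simp add: metric_app_def\<close>)
qed

text \<open>The admissible field representing \<open>\<omega>\<close> on admissible fields: the projection of the field that
  represents it on all fields.\<close>

definition sharp :: "('a vfield \<Rightarrow> 'a \<Rightarrow> real) \<Rightarrow> 'a vfield" where
  "sharp \<omega> = (SOME X. X \<in> \<Gamma>D \<and> (\<forall>Z\<in>\<Gamma>D. \<forall>p. G X Z p = \<omega> Z p))"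

lemma sharp:
  assumes "smooth_linear \<omega>"
  shows "sharp \<omega> \<in> \<Gamma>D" "Z \<in> \<Gamma>D \<Longrightarrow> G (sharp \<omega>) Z p = \<omega> Z p"
proof -
  obtain Y where Y: "Y \<in> vector_fields A" "\<And>Z. Z \<in> vector_fields A \<Longrightarrow> G Y Z = \<omega> Z"
    by (rule representing_field[OF assms]) (rule that)
  have "proj_D \<xi> \<eta> Y \<in> \<Gamma>D \<and> (\<forall>Z\<in>\<Gamma>D. \<forall>p. G (proj_D \<xi> \<eta> Y) Z p = \<omega> Z p)"
    using proj_D_admissible[OF Y(1)] G_proj_D[OF Y(1)] Y(2) admissible_vector_field by simp
  then have "sharp \<omega> \<in> \<Gamma>D \<and> (\<forall>Z\<in>\<Gamma>D. \<forall>p. G (sharp \<omega>) Z p = \<omega> Z p)"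
    unfolding sharp_def by (rule someI[where P = "\<lambda>X. X \<in> \<Gamma>D \<and> (\<forall>Z\<in>\<Gamma>D. \<forall>p. G X Z p = \<omega> Z p)"])
  then show "sharp \<omega> \<in> \<Gamma>D" "Z \<in> \<Gamma>D \<Longrightarrow> G (sharp \<omega>) Z p = \<omega> Z p" by auto
qed

section \<open>The intrinsic connection\<close>

definition metric_connection where
  "metric_connection nabla \<longleftrightarrow> (\<forall>X\<in>\<Gamma>D. \<forall>Y\<in>\<Gamma>D. \<forall>Z\<in>\<Gamma>D. \<forall>p.
     vf_deriv Z (G X Y) p = G (nabla Z X) Y p + G X (nabla Z Y) p)"

definition torsion_free where
  "torsion_free nabla \<longleftrightarrow> (\<forall>X\<in>\<Gamma>D. \<forall>Y\<in>\<Gamma>D. \<forall>p. torsion \<xi> \<eta> nabla X Y p = zero_tvec)"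

text \<open>Pairing with admissible fields removes the projection from the definition of torsion.\<close>

lemma torsion_free_iff:
  assumes nabla: "nabla \<in> \<Gamma>D \<rightarrow> \<Gamma>D \<rightarrow> \<Gamma>D"
  shows "torsion_free nabla \<longleftrightarrow> (\<forall>X\<in>\<Gamma>D. \<forall>Y\<in>\<Gamma>D. \<forall>Z\<in>\<Gamma>D. \<forall>p.
    G (nabla X Y) Z p - G (nabla Y X) Z p = G (lie_bracket X Y) Z p)"
proof -
  have "(\<forall>p. torsion \<xi> \<eta> nabla X Y p = zero_tvec) \<longleftrightarrow>
      (\<forall>Z\<in>\<Gamma>D. \<forall>p. G (nabla X Y) Z p - G (nabla Y X) Z p = G (lie_bracket X Y) Z p)"
    if X: "X \<in> \<Gamma>D" and Y: "Y \<in> \<Gamma>D" for X Y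
  proof -
    let ?W = "vf_comb (\<lambda>p. 1) (nabla X Y) (\<lambda>p. - 1) (nabla Y X)"
    note n = Pi_mem[OF Pi_mem[OF nabla X] Y] Pi_mem[OF Pi_mem[OF nabla Y] X]
    have B: "lie_bracket X Y \<in> vector_fields A"
      using X Y by (intro lie_bracket_vector_field admissible_vector_field)
    have "(\<forall>p. torsion \<xi> \<eta> nabla X Y p = zero_tvec) \<longleftrightarrow> ?W = proj_D \<xi> \<eta> (lie_bracket X Y)"
      by (simp add: torsion_def zero_tvec_def vf_comb_def lincomb_def fun_eq_iff)
    also have "\<dots> \<longleftrightarrow> (\<forall>Z\<in>\<Gamma>D. \<forall>p. G ?W Z p = G (proj_D \<xi> \<eta> (lie_bracket X Y)) Z p)"
    proof (intro iffI)
      assume *: "\<forall>Z\<in>\<Gamma>D. \<forall>p. G ?W Z p = G (proj_D \<xi> \<eta> (lie_bracket X Y)) Z p"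
      show "?W = proj_D \<xi> \<eta> (lie_bracket X Y)"
        by (rule admissible_eqI[OF admissible_comb[OF n smooth_const smooth_const] proj_D_admissible[OF B]])
          (use * in blast)
    qed simp
    also have "\<dots> \<longleftrightarrow> (\<forall>Z\<in>\<Gamma>D. \<forall>p. G (nabla X Y) Z p - G (nabla Y X) Z p = G (lie_bracket X Y) Z p)"
      using n by (simp add: G_proj_D[OF B] G_comb(2) admissible_vector_field)
    finally show ?thesis .
  qed
  then show ?thesis unfolding torsion_free_def by blast
qed

text \<open>Koszul's computation: in the cyclic combination of the three instances of metricity, torsion-freeness
  cancels everything except \<open>2 g(\<nabla>\<^sub>X Y, Z)\<close>.\<close>

lemma metric_torsion_free_koszul:
  assumes nabla: "nabla \<in> \<Gamma>D \<rightarrow> \<Gamma>D \<rightarrow> \<Gamma>D"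
    and met: "metric_connection nabla" and tor: "torsion_free nabla"
    and X: "X \<in> \<Gamma>D" and Y: "Y \<in> \<Gamma>D" and Z: "Z \<in> \<Gamma>D"
  shows "G (nabla X Y) Z p = koszul X Y Z p"
proof -
  have m: "vf_deriv W (G U V) p = G (nabla W U) V p + G (nabla W V) U p"
    if "U \<in> \<Gamma>D" "V \<in> \<Gamma>D" "W \<in> \<Gamma>D" for U V W
    using met that G_sym[of U "nabla W V"] Pi_mem[OF Pi_mem[OF nabla that(3)] that(2)]
      admissible_vector_field
    by (simp add: metric_connection_def)
  have t: "G (lie_bracket U V) W p = G (nabla U V) W p - G (nabla V U) W p"
    if "U \<in> \<Gamma>D" "V \<in> \<Gamma>D" "W \<in> \<Gamma>D" for U V W
    using tor that unfolding torsion_free_iff[OF nabla] by simp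
  show ?thesis
    unfolding koszul_def by (simp add: m t X Y Z)
qed

text \<open>By nondegeneracy on the distribution, every algebraic law of a connection can be tested against
  admissible fields, where it becomes a law of the Koszul expression.\<close>

lemma koszul_imp_intrinsic_connection:
  assumes ext: "nabla \<in> \<Gamma>D \<rightarrow>\<^sub>E (\<Gamma>D \<rightarrow>\<^sub>E \<Gamma>D)"
    and K: "\<And>X Y Z p. X \<in> \<Gamma>D \<Longrightarrow> Y \<in> \<Gamma>D \<Longrightarrow> Z \<in> \<Gamma>D \<Longrightarrow> G (nabla X Y) Z p = koszul X Y Z p"
  shows "intrinsic_connection A \<eta> nabla"
proof -
  have nabla: "nabla X Y \<in> \<Gamma>D" if "X \<in> \<Gamma>D" "Y \<in> \<Gamma>D" for X Y
    using PiE_mem[OF PiE_mem[OF ext that(1)] that(2)] .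
  note [simp] = nabla admissible_comb smooth_const admissible_vector_field vector_fieldD(2)
  have "nabla (vf_comb f U h V) W = vf_comb f (nabla U W) h (nabla V W)"
    if "f \<in> smooth_functions A" "h \<in> smooth_functions A" "U \<in> \<Gamma>D" "V \<in> \<Gamma>D" "W \<in> \<Gamma>D" for f h U V W
    using that by (intro admissible_eqI) (simp_all add: K G_comb(2) koszul_comb_left)
  moreover have "nabla U (vf_comb (\<lambda>p. 1) V (\<lambda>p. 1) W) = vf_comb (\<lambda>p. 1) (nabla U V) (\<lambda>p. 1) (nabla U W)"
    if "U \<in> \<Gamma>D" "V \<in> \<Gamma>D" "W \<in> \<Gamma>D" for U V W
    using that by (intro admissible_eqI) (simp_all add: K G_comb(2) koszul_comb_middle vf_deriv_const)
  moreover have "nabla U (\<lambda>p h. f p * V p h) = vf_comb f (nabla U V) (vf_deriv U f) V"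
    if "f \<in> smooth_functions A" "U \<in> \<Gamma>D" "V \<in> \<Gamma>D" for f U V
  proof -
    have eq: "(\<lambda>p h. f p * V p h) = vf_comb f V (\<lambda>p. 0) V"
      by (simp add: vf_comb_def lincomb_def)
    show ?thesis
      unfolding eq using that
      by (intro admissible_eqI) (simp_all add: K G_comb(2) koszul_comb_middle vf_deriv_const)
  qed
  ultimately show ?thesis
    unfolding intrinsic_connection_def using ext by blast
qed

lemma intrinsic_levi_civita:
  "\<exists>!nabla. intrinsic_connection A \<eta> nabla \<and> metric_connection nabla \<and> torsion_free nabla"
proof -
  define nabla where "nabla = (\<lambda>X\<in>\<Gamma>D. \<lambda>Y\<in>\<Gamma>D. sharp (koszul X Y))"
  note sharp_koszul = sharp[OF koszul_smooth_linear[OF admissible_vector_field admissible_vector_field]]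
  have ext: "nabla \<in> \<Gamma>D \<rightarrow>\<^sub>E (\<Gamma>D \<rightarrow>\<^sub>E \<Gamma>D)"
    unfolding nabla_def by (intro PiE_I) (simp_all add: sharp_koszul(1))
  have K: "G (nabla X Y) Z p = koszul X Y Z p" if "X \<in> \<Gamma>D" "Y \<in> \<Gamma>D" "Z \<in> \<Gamma>D" for X Y Z p
    using that by (simp add: nabla_def sharp_koszul(2))
  have Pi: "nabla \<in> \<Gamma>D \<rightarrow> \<Gamma>D \<rightarrow> \<Gamma>D" using ext by (auto simp: PiE_def Pi_def)
  have nabla: "nabla X Y \<in> \<Gamma>D" if "X \<in> \<Gamma>D" "Y \<in> \<Gamma>D" for X Y
    using Pi_mem[OF Pi_mem[OF Pi that(1)] that(2)] .
  have "metric_connection nabla"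
    unfolding metric_connection_def
  proof (intro ballI allI)
    fix X Y Z p assume XYZ: "X \<in> \<Gamma>D" "Y \<in> \<Gamma>D" "Z \<in> \<Gamma>D"
    have "G X (nabla Z Y) p = koszul Z Y X p"
      using G_sym[of X "nabla Z Y"] K[of Z Y X p] nabla XYZ admissible_vector_field by simp
    then show "vf_deriv Z (G X Y) p = G (nabla Z X) Y p + G X (nabla Z Y) p"
      using K[of Z X Y p] koszul_metric[of X Y Z p] XYZ admissible_vector_field by simp
  qed
  moreover have "torsion_free nabla"
    unfolding torsion_free_iff[OF Pi]
    using K koszul_torsion admissible_vector_field by simp
  moreover have "nabla' = nabla"
    if "intrinsic_connection A \<eta> nabla'" and met: "metric_connection nabla'" and tor: "torsion_free nabla'"
    for nabla'
  proof -
    have ext': "nabla' \<in> \<Gamma>D \<rightarrow>\<^sub>E (\<Gamma>D \<rightarrow>\<^sub>E \<Gamma>D)"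
      using that(1) by (simp add: intrinsic_connection_def)
    have Pi': "nabla' \<in> \<Gamma>D \<rightarrow> \<Gamma>D \<rightarrow> \<Gamma>D" using ext' by (auto simp: PiE_def Pi_def)
    have nabla': "nabla' X Y \<in> \<Gamma>D" if "X \<in> \<Gamma>D" "Y \<in> \<Gamma>D" for X Y
      using Pi_mem[OF Pi_mem[OF Pi' that(1)] that(2)] .
    have "nabla' X Y = nabla X Y" if "X \<in> \<Gamma>D" "Y \<in> \<Gamma>D" for X Y
      by (rule admissible_eqI[OF nabla'[OF that] nabla[OF that]])
        (simp add: K that metric_torsion_free_koszul[OF Pi' met tor])
    then have "nabla' X = nabla X" if "X \<in> \<Gamma>D" for X
      using PiE_ext[OF PiE_mem[OF ext' that] PiE_mem[OF ext that]] that by blast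
    then show ?thesis
      using PiE_ext[OF ext' ext] by blast
  qed
  ultimately show ?thesis
    using koszul_imp_intrinsic_connection[OF ext K] by blast
qed

section \<open>The endomorphism\<close>

text \<open>The tensor \<open>1/2 L\<^sub>\<xi> g\<close> sends an admissible field \<open>X\<close> to a linear form, represented by \<open>F X\<close>. As the tensor
  is symmetric, \<open>F X\<close> at \<open>p\<close> depends on \<open>X\<close> only through \<open>X p\<close>, so \<open>F\<close> is given by an endomorphism of each
  fibre.\<close>

lemma lie_derivative_endomorphism:
  "\<exists>!N. bundle_endomorphism A \<eta> N \<and>
     (\<forall>X\<in>\<Gamma>D. \<forall>Y\<in>\<Gamma>D. \<forall>p. G (endo_app N X) Y p = 1 / 2 * lie_deriv_metric \<xi> g X Y p)"
proof -
  define L where "L X Z = (\<lambda>p. 1 / 2 * lie_deriv_metric \<xi> g X Z p)" for X Z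
  have Llin: "smooth_linear (L X)" if "X \<in> vector_fields A" for X
    unfolding L_def by (rule smooth_linear_scale[OF lie_deriv_metric_smooth_linear[OF xi_field that]])
  have Lsym: "L X Z = L Z X" if "X \<in> vector_fields A" "Z \<in> vector_fields A" for X Z
    using lie_deriv_metric_sym[OF xi_field that] by (simp add: L_def)
  define F where "F X = sharp (L X)" for X
  note sharp_L = sharp[OF Llin[OF admissible_vector_field]]
  have F: "F X \<in> \<Gamma>D" if "X \<in> \<Gamma>D" for X
    unfolding F_def by (rule sharp_L(1)[OF that])
  have FL: "G (F X) Z p = L X Z p" if "X \<in> \<Gamma>D" "Z \<in> \<Gamma>D" for X Z p
    unfolding F_def by (rule sharp_L(2)[OF that])
  have F_at: "F X p = F Y p" if X: "X \<in> \<Gamma>D" and Y: "Y \<in> \<Gamma>D" and XY: "X p = Y p" for X Y p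
  proof (rule g_determined_on_distribution[OF admissible_at[OF F[OF X]] admissible_at[OF F[OF Y]]])
    fix Z assume Z: "Z \<in> \<Gamma>D"
    have "L X Z p = L Y Z p"
      using smooth_linear_tensorial[OF Llin[of Z], of X Y p] X Y Z XY Lsym admissible_vector_field by simp
    then show "g p (F X p) (Z p) = g p (F Y p) (Z p)"
      using FL[OF X Z, of p] FL[OF Y Z, of p] by (simp add: metric_app_def)
  qed
  \<comment> \<open>An admissible extension of \<open>v\<close>; by \<open>F_at\<close> its choice does not affect \<open>N\<close>.\<close>
  define E where "E p v = (SOME X. X \<in> \<Gamma>D \<and> X p = v)" for p v
  have E: "E p v \<in> \<Gamma>D" "E p v p = v" if "v \<in> distribution A \<eta> p" for p v
  proof -
    have "\<exists>X. X \<in> \<Gamma>D \<and> X p = v" using distribution_vector_extends[OF that] by blast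
    then have "E p v \<in> \<Gamma>D \<and> E p v p = v" unfolding E_def by (rule someI_ex)
    then show "E p v \<in> \<Gamma>D" "E p v p = v" by auto
  qed
  define N where "N p = (\<lambda>v\<in>distribution A \<eta> p. F (E p v) p)" for p
  have N: "N p (X p) = F X p" if X: "X \<in> \<Gamma>D" for X p
    using admissible_at[OF X] E F_at[OF _ X] by (simp add: N_def)
  have "linear_endo_on (distribution A \<eta> p) (N p)" for p
    unfolding linear_endo_on_def
  proof (intro conjI ballI allI funcsetI)
    fix v assume v: "v \<in> distribution A \<eta> p"
    show "N p v \<in> distribution A \<eta> p"
      using admissible_at[OF F[OF E(1)[OF v]]] v by (simp add: N_def)
  next
    fix v w a b assume "v \<in> distribution A \<eta> p" "w \<in> distribution A \<eta> p"
    then obtain X Y where X: "X \<in> \<Gamma>D" "X p = v" and Y: "Y \<in> \<Gamma>D" "Y p = w"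
      by (elim distribution_vector_extends) (rule that)
    let ?C = "\<lambda>X Y. vf_comb (\<lambda>p. a) X (\<lambda>p. b) Y"
    have C: "?C X Y \<in> \<Gamma>D" "?C (F X) (F Y) \<in> \<Gamma>D"
      using X Y F by (auto intro: admissible_comb smooth_const)
    have "F (?C X Y) = ?C (F X) (F Y)"
    proof (rule admissible_eqI[OF F[OF C(1)] C(2)])
      fix Z p assume Z: "Z \<in> \<Gamma>D"
      have "L (?C X Y) Z p = a * L X Z p + b * L Y Z p"
        using Llin[of Z] X(1) Y(1) Z C(1) smooth_const Lsym[of _ Z] admissible_vector_field
        by (simp add: smooth_linear_def)
      then show "G (F (?C X Y)) Z p = G (?C (F X) (F Y)) Z p"
        using X(1) Y(1) Z F by (simp add: FL C(1) G_comb(2) admissible_vector_field)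
    qed
    then have "N p (?C X Y p) = ?C (F X) (F Y) p"
      using N[OF C(1)] by simp
    then show "N p (lincomb a v b w) = lincomb a (N p v) b (N p w)"
      using N[OF X(1), of p] N[OF Y(1), of p] unfolding X(2) Y(2) vf_comb_def by simp
  qed
  moreover have NF: "endo_app N X = F X" if "X \<in> \<Gamma>D" for X
    using N[OF that] by (simp add: endo_app_def)
  moreover have "N p \<in> extensional (distribution A \<eta> p)" for p
    by (simp add: N_def)
  ultimately have "bundle_endomorphism A \<eta> N"
    using F by (simp add: bundle_endomorphism_def)
  moreover have "\<forall>X\<in>\<Gamma>D. \<forall>Y\<in>\<Gamma>D. \<forall>p. G (endo_app N X) Y p = L X Y p"
    using NF FL by simp
  moreover have "N' = N"
    if N': "bundle_endomorphism A \<eta> N'" "\<forall>X\<in>\<Gamma>D. \<forall>Y\<in>\<Gamma>D. \<forall>p. G (endo_app N' X) Y p = L X Y p" for N'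
  proof
    fix p
    have "N' p v = N p v" for v
    proof (cases "v \<in> distribution A \<eta> p")
      case True
      then obtain X where X: "X \<in> \<Gamma>D" "X p = v" by (rule distribution_vector_extends)
      have "endo_app N' X = F X"
        by (rule admissible_eqI) (use N' X(1) F FL in \<open>auto simp: bundle_endomorphism_def\<close>)
      then have "N' p (X p) = F X p" by (simp add: endo_app_def fun_eq_iff)
      then show ?thesis using N[OF X(1), of p] unfolding X(2) by simp
    next
      case False
      have "N' p \<in> extensional (distribution A \<eta> p)"
        using N'(1) by (simp add: bundle_endomorphism_def)
      then show ?thesis using False by (simp add: extensional_def N_def)
    qed
    then show "N' p = N p" by (rule ext)
  qed
  ultimately have "\<exists>!N. bundle_endomorphism A \<eta> N \<and>
     (\<forall>X\<in>\<Gamma>D. \<forall>Y\<in>\<Gamma>D. \<forall>p. G (endo_app N X) Y p = L X Y p)"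
    by blast
  then show ?thesis by (simp only: L_def)
qed

lemma lie_derivative_endomorphism_symmetric:
  assumes N: "bundle_endomorphism A \<eta> N"
    and L: "\<forall>X\<in>\<Gamma>D. \<forall>Y\<in>\<Gamma>D. \<forall>p. G (endo_app N X) Y p = 1 / 2 * lie_deriv_metric \<xi> g X Y p"
    and X: "X \<in> \<Gamma>D" and Y: "Y \<in> \<Gamma>D"
  shows "G (endo_app N X) Y p = G X (endo_app N Y) p"
proof -
  have "endo_app N Y \<in> \<Gamma>D" using N Y by (simp add: bundle_endomorphism_def)
  then have "G X (endo_app N Y) p = G (endo_app N Y) X p"
    using G_sym X admissible_vector_field by simp
  moreover have "G (endo_app N X) Y p = 1 / 2 * lie_deriv_metric \<xi> g X Y p"
      "G (endo_app N Y) X p = 1 / 2 * lie_deriv_metric \<xi> g Y X p"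
    using L X Y by blast+
  moreover have "lie_deriv_metric \<xi> g X Y = lie_deriv_metric \<xi> g Y X"
    by (intro lie_deriv_metric_sym xi_field admissible_vector_field X Y)
  ultimately show ?thesis by (simp only:)
qed

end

theorem theorem2:
  fixes A :: "('a::{t2_space, second_countable_topology}, 'n::finite) chart set"
    and \<phi> :: "'a \<Rightarrow> 'a tvec \<Rightarrow> 'a tvec"
    and \<xi> :: "'a vfield"
    and \<eta> :: "'a \<Rightarrow> 'a tvec \<Rightarrow> real"
    and g :: "'a \<Rightarrow> 'a tvec \<Rightarrow> 'a tvec \<Rightarrow> real"
  assumes "almost_contact_metric_structure A \<phi> \<xi> \<eta> g"
    and "odd CARD('n)"
  shows "\<exists>!C. prolonged_connection A \<eta> C \<and>
    (case C of (nabla, N) \<Rightarrow>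
      (\<forall>X\<in>admissible_fields A \<eta>. \<forall>Y\<in>admissible_fields A \<eta>. \<forall>Z\<in>admissible_fields A \<eta>. \<forall>p.
         vf_deriv Z (metric_app g X Y) p
           = metric_app g (nabla Z X) Y p + metric_app g X (nabla Z Y) p) \<and>
      (\<forall>X\<in>admissible_fields A \<eta>. \<forall>Y\<in>admissible_fields A \<eta>. \<forall>p.
         torsion \<xi> \<eta> nabla X Y p = zero_tvec) \<and>
      (\<forall>X\<in>admissible_fields A \<eta>. \<forall>Y\<in>admissible_fields A \<eta>. \<forall>p.
         metric_app g (endo_app N X) Y p = metric_app g X (endo_app N Y) p) \<and>
      (\<forall>X\<in>admissible_fields A \<eta>. \<forall>Y\<in>admissible_fields A \<eta>. \<forall>p.
         metric_app g (endo_app N X) Y p = 1 / 2 * lie_deriv_metric \<xi> g X Y p))"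
proof -
  interpret almost_contact_metric_structure A \<phi> \<xi> \<eta> g by (rule assms(1))
  obtain nabla where nabla: "intrinsic_connection A \<eta> nabla" "metric_connection nabla" "torsion_free nabla"
    and nabla_unique: "\<And>n. intrinsic_connection A \<eta> n \<Longrightarrow> metric_connection n \<Longrightarrow> torsion_free n \<Longrightarrow> n = nabla"
    using intrinsic_levi_civita by blast
  obtain N where N: "bundle_endomorphism A \<eta> N"
      "\<forall>X\<in>\<Gamma>D. \<forall>Y\<in>\<Gamma>D. \<forall>p. G (endo_app N X) Y p = 1 / 2 * lie_deriv_metric \<xi> g X Y p"
    and N_unique: "\<And>N'. bundle_endomorphism A \<eta> N' \<Longrightarrow>
      \<forall>X\<in>\<Gamma>D. \<forall>Y\<in>\<Gamma>D. \<forall>p. G (endo_app N' X) Y p = 1 / 2 * lie_deriv_metric \<xi> g X Y p \<Longrightarrow> N' = N"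
    using lie_derivative_endomorphism by blast
  show ?thesis
  proof (rule ex1I[of _ "(nabla, N)"])
    show "prolonged_connection A \<eta> (nabla, N) \<and> (case (nabla, N) of (nabla, N) \<Rightarrow>
      (\<forall>X\<in>\<Gamma>D. \<forall>Y\<in>\<Gamma>D. \<forall>Z\<in>\<Gamma>D. \<forall>p.
         vf_deriv Z (G X Y) p = G (nabla Z X) Y p + G X (nabla Z Y) p) \<and>
      (\<forall>X\<in>\<Gamma>D. \<forall>Y\<in>\<Gamma>D. \<forall>p. torsion \<xi> \<eta> nabla X Y p = zero_tvec) \<and>
      (\<forall>X\<in>\<Gamma>D. \<forall>Y\<in>\<Gamma>D. \<forall>p. G (endo_app N X) Y p = G X (endo_app N Y) p) \<and>
      (\<forall>X\<in>\<Gamma>D. \<forall>Y\<in>\<Gamma>D. \<forall>p. G (endo_app N X) Y p = 1 / 2 * lie_deriv_metric \<xi> g X Y p))"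
      using nabla N lie_derivative_endomorphism_symmetric[OF N]
      by (simp add: prolonged_connection_def metric_connection_def torsion_free_def)
  qed (use nabla_unique N_unique in
      \<open>auto simp: prolonged_connection_def metric_connection_def torsion_free_def\<close>)
qed

end
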